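(* Let $(V,\{f_i\}_{i\in I})$ be a pre-dual perfect space over a field $\mathbf{k}$ such that $\dim V_\lambda<\infty$ for any $\lambda\in P$. Let $\mathbf{B}$ be a basis of $V$ and let $\mathbf{B}^\vee\subset V^\vee$ be the dual basis of $\mathbf{B}$, where $V^\vee$ is the graded dual of $V$, equipped with the operators $e_i$ transpose to $f_i$. Then: (i) $\mathbf{B}$ is a dual perfect basis of $(V,\{f_i\}_{i\in I})$ if and only if $\mathbf{B}^\vee$ is a perfect basis of $(V^\vee,\{e_i\}_{i\in I})$. (ii) Assume that $\mathbf{B}$ is a dual perfect basis. Denoting the canonical bijection $\mathbf{B}\to\mathbf{B}^\vee$ by $b\mapsto b^\vee$, we have $$\ell_i(b)=\ell_i^\vee(b^\vee)\quad\text{and}\quad(\mathbf{e}_ib)^\vee=\mathbf{E}_i(b^\vee)\quad\text{for all }b\in\mathbf{B}\text{ and }i\in I,$$ where we understand $0^\vee=0$.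
   Context: **Borcherds–Cartan datum.** Let $I$ be an index set. A symmetrizable Borcherds–Cartan matrix is an integral matrix $A=(a_{ij})_{i,j\in I}$ with $a_{ii}=2$ or $a_{ii}\le 0$; $a_{ij}\le 0$ for $i\ne j$; $a_{ij}=0\iff a_{ji}=0$; and $DA$ symmetric for some $D=\mathrm{diag}(s_i\in\mathbb{Z}_{>0})_{i\in I}$. Assume $a_{ii}\in 2\mathbb{Z}$ for all $i$. Fix a Borcherds–Cartan datum $(A,P,\Pi,\Pi^\vee)$: $P$ is a free abelian group, $\Pi=\{\alpha_i\}_{i\in I}\subset P$ is linearly independent, $\Pi^\vee=\{h_i\}_{i\in I}\subset\mathrm{Hom}(P,\mathbb{Z})$, $\langle h_i,\alpha_j\rangle=a_{ij}$, and for each $i$ there is $\Lambda_i\in P$ with $\langle h_j,\Lambda_i\rangle=\delta_{ij}$ for all $j$. Put $Q^+=\sum_i\mathbb{Z}_{\ge0}\alpha_i$. For a $P$-graded space $V$, $\mathrm{wt}(V)=\{\mu\in P:V_\mu\ne0\}$. **Dual perfect bases.** Let $V=\bigoplus_{\mu\in P}V_\mu$ be a $P$-graded $\mathbf{k}$-vector space with endomorphisms $\{f_i\}_{i\in I}$. $(V,\{f_i\})$ is a pre-dual perfect space if $\mathrm{wt}(V)\subset\bigcup_{j=1}^k(\lambda_j-Q^+)$ for some finitely many $\lambda_j\in P$ and $f_i(V_\mu)\subset V_{\mu-\alpha_i}$ for all $i,\mu$. For $v\in V\setminus\{0\}$, $\ell_i(v)$ is the integer $n\ge0$ with $v\in f_i^nV\setminus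 f_i^{n+1}V$. A basis $\mathbf{B}$ of $V$ is a dual perfect basis if (a) $\mathbf{B}=\bigsqcup_\mu(\mathbf{B}\cap V_\mu)$; (b) for any $i\in I$ there is a map $\mathbf{f}_i\colon\mathbf{B}\to\mathbf{B}\cup\{0\}$ such that for any $b\in\mathbf{B}$ there is $c\in\mathbf{k}^\times$ with $f_i(b)-c\,\mathbf{f}_i(b)\in f_i^{\ell_i(b)+2}V$; (c) if $\mathbf{f}_i(b)=\mathbf{f}_i(b')\ne0$ then $b=b'$. For a dual perfect basis, $\mathbf{e}_ib=b'$ if $b'\in\mathbf{B}$ satisfies $\mathbf{f}_ib'=b$, and $\mathbf{e}_ib=0$ if there is no such $b'$. **Perfect bases.** Let $W=\bigoplus_{\mu\in P}W_\mu$ be a $P$-graded $\mathbf{k}$-vector space with endomorphisms $\{e_i\}_{i\in I}$ such that $\mathrm{wt}(W)\subset\bigcup_{j=1}^k(\lambda_j-Q^+)$ for some finitely many $\lambda_j\in P$ and $e_i(W_\mu)\subset W_{\mu+\alpha_i}$. For $v\in W\setminus\{0\}$ put $\ell_i^\vee(v)=\max\{n\ge0: e_i^nv\ne0\}$. A basis $\mathbb{B}$ of $W$ is perfect if (1) $\mathbb{B}=\bigsqcup_\mu(\mathbb{B}\cap W_\mu)$; (2) for any $i\in I$ there is a map $\mathbf{E}_i\colon\mathbb{B}\to\mathbb{B}\cup\{0\}$ such that for any $b\in\mathbb{B}$: if $\ell_i^\vee(b)=0$ then $\mathbf{E}_i(b)=0$; if $\ell_i^\vee(b)>0$ then $\mathbf{E}_i(b)\in\mathbb{B}$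 and $e_i(b)-c\,\mathbf{E}_i(b)\in\ker e_i^{\ell_i^\vee(b)-1}$ for some $c\in\mathbf{k}^\times$; (3) if $\mathbf{E}_i(b)=\mathbf{E}_i(b')\ne0$ then $b=b'$. **Duals.** $(V^\vee)_\lambda=\mathrm{Hom}_{\mathbf{k}}(V_\lambda,\mathbf{k})$, $V^\vee=\bigoplus_{\lambda\in P}(V^\vee)_\lambda$, $\langle\cdot,\cdot\rangle\colon V\times V^\vee\to\mathbf{k}$ is the canonical pairing, and $e_i\colon V^\vee\to V^\vee$ is the transpose of $f_i$: $\langle u,e_iv\rangle=\langle f_iu,v\rangle$. The dual basis $\mathbf{B}^\vee=\{b^\vee:b\in\mathbf{B}\}\subset V^\vee$ is the basis of $V^\vee$ with $\langle b,b'^\vee\rangle=\delta_{b,b'}$. *)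

theory Defs
  imports Main "HOL.Vector_Spaces" "HOL-Library.Function_Algebras" "HOL-Library.FuncSet"
    "HOL-Library.Disjoint_Sets"
begin

section \<open>Abelian groups as modules over the integers\<close>

definition int_scale :: "int \<Rightarrow> 'a::ab_group_add \<Rightarrow> 'a" where
  "int_scale n x = (\<Sum>k<nat n. x) - (\<Sum>k<nat (- n). x)"

lemma int_scale_diff: "int_scale (int a - int b) x = (\<Sum>k<a. x) - (\<Sum>k<b. x)"
proof -
  have add: "(\<Sum>k<m + n. y) = (\<Sum>k<m. y) + (\<Sum>k<n. y)" for m n :: nat and y :: 'a
    by (induction n) (auto simp: algebra_simps)
  show ?thesis
  proof (cases "a \<le> b")
    case True
    then obtain d where "b = a + d" using le_Suc_ex by blast
    then show ?thesis by (simp add: int_scale_def add)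
  next
    case False
    then obtain d where "a = b + d" by (metis le_Suc_ex nat_le_linear)
    then show ?thesis by (simp add: int_scale_def add)
  qed
qed

lemma int_scale_simps:
  "int_scale 0 x = 0" "int_scale 1 x = x"
  by (simp_all add: int_scale_def)

lemma int_scale_add_left: "int_scale (m + n) x = int_scale m x + int_scale n x"
proof -
  have add: "(\<Sum>k<a + b. x) = (\<Sum>k<a. x) + (\<Sum>k<b. x)" for a b :: nat
    by (induction b) (auto simp: algebra_simps)
  obtain a b where m: "m = int a - int b"
    by (metis diff_zero int_diff_cases of_nat_0)
  obtain c d where n: "n = int c - int d"
    by (metis diff_zero int_diff_cases of_nat_0)
  have mn: "m + n = int (a + c) - int (b + d)"
    by (simp add: m n)
  show ?thesis
    unfolding mn unfolding m n int_scale_diff by (simp add: add algebra_simps)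
qed

lemma int_scale_add_right: "int_scale n (x + y) = int_scale n x + int_scale n y"
  by (simp add: int_scale_def sum.distrib algebra_simps)

lemma int_scale_minus_left: "int_scale (- n) x = - int_scale n x"
  using int_scale_add_left[of n "- n" x] by (simp add: int_scale_simps eq_neg_iff_add_eq_0 add.commute)

lemma module_int_scale: "module (int_scale :: int \<Rightarrow> 'a::ab_group_add \<Rightarrow> 'a)"
proof
  fix m n :: int and x :: 'a
  show "int_scale m (int_scale n x) = int_scale (m * n) x"
  proof (induction m rule: int_induct[where k = 0])
    case base
    show ?case by (simp add: int_scale_simps)
  next
    case (step1 i)
    then show ?case
      by (simp add: int_scale_add_left int_scale_simps algebra_simps)
  next
    case (step2 i)
    have "int_scale (i - 1) (int_scale n x) = int_scale (i * n) x - int_scale n x"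
      using int_scale_add_left[of i "- 1" "int_scale n x"] step2
      by (simp add: int_scale_minus_left int_scale_simps)
    moreover have "int_scale ((i - 1) * n) x = int_scale (i * n) x - int_scale n x"
      using int_scale_add_left[of "i * n" "- n" x]
      by (simp add: int_scale_minus_left algebra_simps)
    ultimately show ?case by simp
  qed
qed (simp_all add: int_scale_simps int_scale_add_left int_scale_add_right)


section \<open>Borcherds--Cartan data\<close>

text \<open>The free abelian group \<open>P\<close> is the type \<^typ>\<open>'p\<close>.\<close>

locale borcherds_cartan_datum =
  fixes I :: "'i set"
    and A :: "'i \<Rightarrow> 'i \<Rightarrow> int"
    and \<alpha> :: "'i \<Rightarrow> 'p::ab_group_add"
    and h :: "'i \<Rightarrow> 'p \<Rightarrow> int"
  assumes diagonal: "\<And>i. i \<in> I \<Longrightarrow> A i i = 2 \<or> A i i \<le> 0"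
    and off_diagonal: "\<And>i j. i \<in> I \<Longrightarrow> j \<in> I \<Longrightarrow> i \<noteq> j \<Longrightarrow> A i j \<le> 0"
    and zero_iff: "\<And>i j. i \<in> I \<Longrightarrow> j \<in> I \<Longrightarrow> A i j = 0 \<longleftrightarrow> A j i = 0"
    and symmetrizable:
      "\<exists>s :: 'i \<Rightarrow> int. (\<forall>i\<in>I. s i > 0) \<and> (\<forall>i\<in>I. \<forall>j\<in>I. s i * A i j = s j * A j i)"
    and even_diagonal: "\<And>i. i \<in> I \<Longrightarrow> even (A i i)"
    and free: "\<exists>X :: 'p set. \<not> module.dependent int_scale X \<and> module.span int_scale X = UNIV"
    and roots_independent: "inj_on \<alpha> I" "\<not> module.dependent int_scale (\<alpha> ` I)"
    and coroots_hom: "\<And>i. i \<in> I \<Longrightarrow> additive (h i)"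
    and coroots_roots: "\<And>i j. i \<in> I \<Longrightarrow> j \<in> I \<Longrightarrow> h i (\<alpha> j) = A i j"
    and fundamental_weights:
      "\<And>i. i \<in> I \<Longrightarrow> \<exists>\<Lambda>. \<forall>j\<in>I. h j \<Lambda> = (if i = j then 1 else 0)"

definition root_cone :: "'i set \<Rightarrow> ('i \<Rightarrow> 'p::ab_group_add) \<Rightarrow> 'p set" where
  "root_cone I \<alpha> = {\<Sum>i\<in>J. int_scale (int (n i)) (\<alpha> i) | J n. finite J \<and> J \<subseteq> I}"


section \<open>Graded vector spaces\<close>

text \<open>
  Graded spaces are given by a subspace \<open>W\<close> of an ambient vector space and its homogeneous
  components. The ambient space is needed because the graded dual is not a type of its own.
\<close>

locale graded_space = vector_space scale
  for scale :: "'k::field \<Rightarrow> 'w::ab_group_add \<Rightarrow> 'w" +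
  fixes W :: "'w set"
    and Wg :: "'p::ab_group_add \<Rightarrow> 'w set"
  assumes subspace_component: "subspace (Wg \<mu>)"
    and span_components: "span (\<Union>\<mu>. Wg \<mu>) = W"
    and direct: "finite S \<Longrightarrow> (\<And>\<mu>. \<mu> \<in> S \<Longrightarrow> x \<mu> \<in> Wg \<mu>) \<Longrightarrow> (\<Sum>\<mu>\<in>S. x \<mu>) = 0
                   \<Longrightarrow> \<mu> \<in> S \<Longrightarrow> x \<mu> = 0"

definition weights :: "('p \<Rightarrow> 'w::zero set) \<Rightarrow> 'p set" where
  "weights Wg = {\<mu>. Wg \<mu> \<noteq> {0}}"

definition weights_bounded ::
    "'i set \<Rightarrow> ('i \<Rightarrow> 'p::ab_group_add) \<Rightarrow> ('p \<Rightarrow> 'w::zero set) \<Rightarrow> bool" where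
  "weights_bounded I \<alpha> Wg \<longleftrightarrow>
     (\<exists>L. finite L \<and> weights Wg \<subseteq> (\<Union>\<kappa>\<in>L. {\<kappa> - q | q. q \<in> root_cone I \<alpha>}))"

definition finite_dim :: "('k::field \<Rightarrow> 'w::ab_group_add \<Rightarrow> 'w) \<Rightarrow> 'w set \<Rightarrow> bool" where
  "finite_dim scale U \<longleftrightarrow> (\<exists>S. finite S \<and> module.span scale S = U)"

definition is_basis :: "('k::field \<Rightarrow> 'w::ab_group_add \<Rightarrow> 'w) \<Rightarrow> 'w set \<Rightarrow> 'w set \<Rightarrow> bool" where
  "is_basis scale W B \<longleftrightarrow> B \<subseteq> W \<and> \<not> module.dependent scale B \<and> module.span scale B = W"

definition homogeneous :: "('p \<Rightarrow> 'w set) \<Rightarrow> 'w set \<Rightarrow> bool" where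
  "homogeneous Wg B \<longleftrightarrow> B = (\<Union>\<mu>. B \<inter> Wg \<mu>) \<and> disjoint_family (\<lambda>\<mu>. B \<inter> Wg \<mu>)"


section \<open>Dual perfect bases\<close>

text \<open>Here \<open>V\<close> is the whole type \<^typ>\<open>'v\<close>, with homogeneous components \<open>V \<mu>\<close>.\<close>

locale pre_dual_perfect_space =
  borcherds_cartan_datum I A \<alpha> h + graded_space scale UNIV V
  for I :: "'i set" and A and \<alpha> :: "'i \<Rightarrow> 'p::ab_group_add" and h
    and scale :: "'k::field \<Rightarrow> 'v::ab_group_add \<Rightarrow> 'v" and V :: "'p \<Rightarrow> 'v set" +
  fixes f :: "'i \<Rightarrow> 'v \<Rightarrow> 'v"
  assumes bounded: "weights_bounded I \<alpha> V"
    and linear_f: "i \<in> I \<Longrightarrow> Vector_Spaces.linear scale scale (f i)"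
    and f_weight: "i \<in> I \<Longrightarrow> f i ` V \<mu> \<subseteq> V (\<mu> - \<alpha> i)"

text \<open>
  In the following definitions \<open>g\<close> is a single operator \<open>f\<^sub>i\<close> or \<open>e\<^sub>i\<close>. The functions \<open>\<ell>\<close> are
  meaningful for nonzero arguments only. Maps to \<open>B \<union> {0}\<close> take the zero vector for \<open>0\<close>.
\<close>

definition ell :: "('v \<Rightarrow> 'v) \<Rightarrow> 'v \<Rightarrow> nat" where
  "ell g v = (THE n. v \<in> range (g ^^ n) - range (g ^^ Suc n))"

definition dual_perfect_map ::
    "('k::field \<Rightarrow> 'v::ab_group_add \<Rightarrow> 'v) \<Rightarrow> ('v \<Rightarrow> 'v) \<Rightarrow> 'v set \<Rightarrow> ('v \<Rightarrow> 'v) \<Rightarrow> bool" where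
  "dual_perfect_map scale g B F \<longleftrightarrow>
     F \<in> B \<rightarrow> B \<union> {0} \<and>
     (\<forall>b\<in>B. \<exists>c. c \<noteq> 0 \<and> g b - scale c (F b) \<in> range (g ^^ (ell g b + 2))) \<and>
     (\<forall>b\<in>B. \<forall>b'\<in>B. F b = F b' \<and> F b \<noteq> 0 \<longrightarrow> b = b')"

definition dual_perfect_basis ::
    "'i set \<Rightarrow> ('k::field \<Rightarrow> 'v::ab_group_add \<Rightarrow> 'v) \<Rightarrow> ('p \<Rightarrow> 'v set) \<Rightarrow> ('i \<Rightarrow> 'v \<Rightarrow> 'v)
       \<Rightarrow> 'v set \<Rightarrow> bool" where
  "dual_perfect_basis I scale V f B \<longleftrightarrow>
     is_basis scale UNIV B \<and> homogeneous V B \<and> (\<forall>i\<in>I. \<exists>F. dual_perfect_map scale (f i) B F)"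

text \<open>The operator \<open>\<^bold>e\<^sub>i\<close> obtained from \<open>F = \<^bold>f\<^sub>i\<close>.\<close>

definition raising :: "'v::zero set \<Rightarrow> ('v \<Rightarrow> 'v) \<Rightarrow> 'v \<Rightarrow> 'v" where
  "raising B F b = (if \<exists>b'\<in>B. F b' = b then THE b'. b' \<in> B \<and> F b' = b else 0)"


section \<open>Perfect bases\<close>

locale pre_perfect_space =
  borcherds_cartan_datum I A \<alpha> h + graded_space scale W Wg
  for I :: "'i set" and A and \<alpha> :: "'i \<Rightarrow> 'p::ab_group_add" and h
    and scale :: "'k::field \<Rightarrow> 'w::ab_group_add \<Rightarrow> 'w" and W and Wg :: "'p \<Rightarrow> 'w set" +
  fixes e :: "'i \<Rightarrow> 'w \<Rightarrow> 'w"
  assumes bounded: "weights_bounded I \<alpha> Wg"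
    and e_closed: "i \<in> I \<Longrightarrow> e i \<in> W \<rightarrow> W"
    and e_add: "i \<in> I \<Longrightarrow> x \<in> W \<Longrightarrow> y \<in> W \<Longrightarrow> e i (x + y) = e i x + e i y"
    and e_scale: "i \<in> I \<Longrightarrow> x \<in> W \<Longrightarrow> e i (scale c x) = scale c (e i x)"
    and e_weight: "i \<in> I \<Longrightarrow> e i ` Wg \<mu> \<subseteq> Wg (\<mu> + \<alpha> i)"

definition ell_check :: "('w::zero \<Rightarrow> 'w) \<Rightarrow> 'w \<Rightarrow> nat" where
  "ell_check g v = Max {n. (g ^^ n) v \<noteq> 0}"

definition perfect_map ::
    "('k::field \<Rightarrow> 'w::ab_group_add \<Rightarrow> 'w) \<Rightarrow> 'w set \<Rightarrow> ('w \<Rightarrow> 'w) \<Rightarrow> 'w set \<Rightarrow> ('w \<Rightarrow> 'w) \<Rightarrow> bool"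
  where
  "perfect_map scale W g B E \<longleftrightarrow>
     E \<in> B \<rightarrow> B \<union> {0} \<and>
     (\<forall>b\<in>B. ell_check g b = 0 \<longrightarrow> E b = 0) \<and>
     (\<forall>b\<in>B. ell_check g b > 0 \<longrightarrow> E b \<in> B \<and>
        (\<exists>c. c \<noteq> 0 \<and> g b - scale c (E b) \<in> {w \<in> W. (g ^^ (ell_check g b - 1)) w = 0})) \<and>
     (\<forall>b\<in>B. \<forall>b'\<in>B. E b = E b' \<and> E b \<noteq> 0 \<longrightarrow> b = b')"

definition perfect_basis ::
    "'i set \<Rightarrow> ('k::field \<Rightarrow> 'w::ab_group_add \<Rightarrow> 'w) \<Rightarrow> 'w set \<Rightarrow> ('p \<Rightarrow> 'w set)
       \<Rightarrow> ('i \<Rightarrow> 'w \<Rightarrow> 'w) \<Rightarrow> 'w set \<Rightarrow> bool" where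
  "perfect_basis I scale W Wg e B \<longleftrightarrow>
     is_basis scale W B \<and> homogeneous Wg B \<and> (\<forall>i\<in>I. \<exists>E. perfect_map scale W (e i) B E)"


section \<open>The graded dual\<close>

text \<open>
  A functional on \<open>V \<kappa>\<close> is represented by its extension to \<open>V\<close> that vanishes on the other
  components; lemma \<open>dual_comp_bij\<close> below identifies \<open>dual_comp scale V \<kappa>\<close> with \<open>Hom (V \<kappa>, k)\<close>.
  Thus the canonical pairing of \<open>u\<close> and \<open>\<phi>\<close> is \<open>\<phi> u\<close>.
\<close>

definition dual_scale :: "'k::field \<Rightarrow> ('v \<Rightarrow> 'k) \<Rightarrow> 'v \<Rightarrow> 'k" where
  "dual_scale c \<phi> = (\<lambda>v. c * \<phi> v)"

definition dual_comp ::
    "('k::field \<Rightarrow> 'v::ab_group_add \<Rightarrow> 'v) \<Rightarrow> ('p \<Rightarrow> 'v set) \<Rightarrow> 'p \<Rightarrow> ('v \<Rightarrow> 'k) set" where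
  "dual_comp scale V \<kappa> =
     {\<phi>. Vector_Spaces.linear scale (*) \<phi> \<and> (\<forall>\<mu>. \<mu> \<noteq> \<kappa> \<longrightarrow> (\<forall>v\<in>V \<mu>. \<phi> v = 0))}"

definition graded_dual ::
    "('k::field \<Rightarrow> 'v::ab_group_add \<Rightarrow> 'v) \<Rightarrow> ('p \<Rightarrow> 'v set) \<Rightarrow> ('v \<Rightarrow> 'k) set" where
  "graded_dual scale V = module.span dual_scale (\<Union>\<kappa>. dual_comp scale V \<kappa>)"

definition transpose_op :: "('v \<Rightarrow> 'v) \<Rightarrow> ('v \<Rightarrow> 'k) \<Rightarrow> 'v \<Rightarrow> 'k" where
  "transpose_op g \<phi> = \<phi> \<circ> g"

text \<open>
  The vector \<open>b\<^sup>\<or>\<close> for \<open>b \<in> B\<close>, with \<open>0\<^sup>\<or> = 0\<close>. It is the \<open>b\<close>-th coordinate functional with respect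
  to the basis \<open>B\<close>, the only linear functional with the required values on \<open>B\<close>. For a basis
  \<open>B\<close> that is not homogeneous it need not lie in the graded dual.
\<close>

definition dual_vector ::
    "('k::field \<Rightarrow> 'v::ab_group_add \<Rightarrow> 'v) \<Rightarrow> 'v set \<Rightarrow> 'v \<Rightarrow> 'v \<Rightarrow> 'k" where
  "dual_vector scale B b = (if b = 0 then 0 else (\<lambda>v. module.representation scale B v b))"

lemma vector_space_dual_scale: "vector_space (dual_scale :: 'k::field \<Rightarrow> ('v \<Rightarrow> 'k) \<Rightarrow> 'v \<Rightarrow> 'k)"
  by unfold_locales (auto simp: dual_scale_def fun_eq_iff algebra_simps)

lemma dual_vector:
  assumes "vector_space scale" and "is_basis scale UNIV B" and "b \<in> B"
  shows "Vector_Spaces.linear scale (*) (dual_vector scale B b)"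
    and "b' \<in> B \<Longrightarrow> dual_vector scale B b b' = (if b = b' then 1 else 0)"
proof -
  interpret vector_space scale by fact
  have B: "independent B" "span B = UNIV" and "b \<noteq> 0"
    using assms(2,3) dependent_zero by (auto simp: is_basis_def)
  then have *: "dual_vector scale B b = (\<lambda>v. representation B v b)"
    by (simp add: dual_vector_def)
  show "Vector_Spaces.linear scale (*) (dual_vector scale B b)"
    unfolding * using B by (rule linear_representation)
  show "dual_vector scale B b b' = (if b = b' then 1 else 0)" if "b' \<in> B"
    unfolding * using B(1) that by (auto simp: representation_basis)
qed

context graded_space
begin

lemma other_components:
  assumes "u \<in> span (\<Union>\<mu>\<in>- {\<kappa>}. Wg \<mu>)"
  shows "\<exists>S y. finite S \<and> \<kappa> \<notin> S \<and> (\<forall>\<mu>. y \<mu> \<in> Wg \<mu>) \<and> u = (\<Sum>\<mu>\<in>S. y \<mu>)"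
  using assms
proof (induction rule: span_induct_alt)
  case base
  show ?case
    by (intro exI[of _ "{}"] exI[of _ "\<lambda>_. 0"]) (simp add: subspace_0[OF subspace_component])
next
  case (step c x u)
  then obtain S y where S: "finite S" "\<kappa> \<notin> S" "\<forall>\<mu>. y \<mu> \<in> Wg \<mu>" "u = (\<Sum>\<mu>\<in>S. y \<mu>)"
    by blast
  obtain \<nu> where \<nu>: "\<nu> \<noteq> \<kappa>" "x \<in> Wg \<nu>"
    using step by auto
  define y1 where "y1 = (\<lambda>\<mu>. if \<mu> \<in> S then y \<mu> else 0)"
  define y2 where "y2 = (\<lambda>\<mu>. if \<mu> = \<nu> then scale c x else 0)"
  have "(\<Sum>\<mu>\<in>insert \<nu> S. y1 \<mu>) = u"
    unfolding S(4) y1_def using S(1) by (intro sum.mono_neutral_cong_right) auto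
  moreover have "(\<Sum>\<mu>\<in>insert \<nu> S. y2 \<mu>) = scale c x"
    unfolding y2_def using S(1) by (subst sum.delta) auto
  ultimately have "scale c x + u = (\<Sum>\<mu>\<in>insert \<nu> S. y1 \<mu> + y2 \<mu>)"
    by (simp only: sum.distrib add.commute)
  moreover have "y1 \<mu> + y2 \<mu> \<in> Wg \<mu>" for \<mu>
    using S(3) \<nu>(2) unfolding y1_def y2_def
    by (auto intro!: subspace_add[OF subspace_component] subspace_scale[OF subspace_component]
        subspace_0[OF subspace_component])
  ultimately show ?case
    using S(1,2) \<nu>(1) by (intro exI[of _ "insert \<nu> S"] exI[of _ "\<lambda>\<mu>. y1 \<mu> + y2 \<mu>"]) auto
qed

lemma component_inter_others:
  assumes "x \<in> Wg \<kappa>" "x \<in> span (\<Union>\<mu>\<in>- {\<kappa>}. Wg \<mu>)"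
  shows "x = 0"
proof -
  obtain S y where S: "finite S" "\<kappa> \<notin> S" "\<forall>\<mu>. y \<mu> \<in> Wg \<mu>" "x = (\<Sum>\<mu>\<in>S. y \<mu>)"
    using other_components[OF assms(2)] by blast
  define z where "z = y(\<kappa> := - x)"
  have "(\<Sum>\<mu>\<in>S. z \<mu>) = x"
    unfolding S(4) z_def using S(2) by (intro sum.cong) auto
  then have "(\<Sum>\<mu>\<in>insert \<kappa> S. z \<mu>) = 0"
    using S(1,2) by (simp add: z_def)
  moreover have "z \<mu> \<in> Wg \<mu>" for \<mu>
    using S(3) assms(1) by (simp add: z_def subspace_neg[OF subspace_component])
  ultimately have "z \<kappa> = 0"
    using direct[of "insert \<kappa> S" z \<kappa>] S(1) by auto
  then show ?thesis by (simp add: z_def)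
qed

end

lemma (in graded_space) linear_functional_extension:
  assumes W: "W = UNIV"
    and add: "\<And>x y. x \<in> Wg \<kappa> \<Longrightarrow> y \<in> Wg \<kappa> \<Longrightarrow> \<psi> (x + y) = \<psi> x + \<psi> y"
    and scale: "\<And>c x. x \<in> Wg \<kappa> \<Longrightarrow> \<psi> (scale c x) = c * \<psi> x"
  shows "\<exists>\<phi>\<in>dual_comp scale Wg \<kappa>. \<forall>x\<in>Wg \<kappa>. \<phi> x = \<psi> x"
proof -
  let ?U = "span (\<Union>\<mu>\<in>- {\<kappa>}. Wg \<mu>)"
  have "(\<Union>\<mu>. Wg \<mu>) = Wg \<kappa> \<union> (\<Union>\<mu>\<in>- {\<kappa>}. Wg \<mu>)"
    by auto
  then have "UNIV = {x + y | x y. x \<in> span (Wg \<kappa>) \<and> y \<in> ?U}"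
    using span_components W span_Un[of "Wg \<kappa>" "\<Union>\<mu>\<in>- {\<kappa>}. Wg \<mu>"] by metis
  then have ex: "\<exists>x. x \<in> Wg \<kappa> \<and> v - x \<in> ?U" for v
  proof -
    assume "UNIV = {x + y | x y. x \<in> span (Wg \<kappa>) \<and> y \<in> ?U}"
    then have "v \<in> {x + y | x y. x \<in> span (Wg \<kappa>) \<and> y \<in> ?U}"
      by blast
    then obtain x y where "v = x + y" "x \<in> span (Wg \<kappa>)" "y \<in> ?U"
      by blast
    then show ?thesis
      by (metis add_diff_cancel_left' subspace_component span_eq_iff)
  qed
  obtain p where p: "\<And>v. p v \<in> Wg \<kappa>" "\<And>v. v - p v \<in> ?U"
    using ex by metis
  have uniq: "p v = x" if "x \<in> Wg \<kappa>" "v - x \<in> ?U" for v x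
  proof -
    have "p v - x \<in> Wg \<kappa>"
      using subspace_diff[OF subspace_component p(1) that(1)] .
    moreover have "p v - x \<in> ?U"
      using span_diff[OF that(2) p(2)[of v]] by (simp add: algebra_simps)
    ultimately show ?thesis
      using component_inter_others by fastforce
  qed
  have padd: "p (x + y) = p x + p y" for x y
  proof (rule uniq)
    show "p x + p y \<in> Wg \<kappa>"
      by (intro subspace_add[OF subspace_component] p)
    show "x + y - (p x + p y) \<in> ?U"
      using span_add[OF p(2)[of x] p(2)[of y]] by (simp add: algebra_simps)
  qed
  have pscale: "p (scale c x) = scale c (p x)" for c x
  proof (rule uniq)
    show "scale c (p x) \<in> Wg \<kappa>"
      by (intro subspace_scale[OF subspace_component] p)
    show "scale c x - scale c (p x) \<in> ?U"
      using span_scale[OF p(2)[of x], of c] by (simp add: algebra_simps)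
  qed
  have "Vector_Spaces.linear scale (*) (\<lambda>v. \<psi> (p v))"
    by unfold_locales (simp_all add: padd pscale add scale p algebra_simps)
  moreover have "\<psi> (p v) = 0" if "\<mu> \<noteq> \<kappa>" "v \<in> Wg \<mu>" for \<mu> v
  proof -
    have "v \<in> ?U"
      using that by (auto intro: span_base)
    then have "p v = 0"
      by (intro uniq) (auto simp: subspace_0[OF subspace_component])
    then show ?thesis
      using scale[of 0 0] subspace_0[OF subspace_component] by simp
  qed
  moreover have "\<psi> (p x) = \<psi> x" if "x \<in> Wg \<kappa>" for x
    using uniq[of x x] that by (simp add: span_zero)
  ultimately show ?thesis
    by (intro bexI[of _ "\<lambda>v. \<psi> (p v)"]) (auto simp: dual_comp_def)
qed

lemma dual_comp_eqI:
  assumes "graded_space scale UNIV V" "\<phi> \<in> dual_comp scale V \<kappa>" "\<phi>' \<in> dual_comp scale V \<kappa>"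
    and eq: "\<And>x. x \<in> V \<kappa> \<Longrightarrow> \<phi> x = \<phi>' x"
  shows "\<phi> = \<phi>'"
proof
  interpret graded_space scale UNIV V by fact
  interpret \<phi>: Vector_Spaces.linear scale "(*)" \<phi> using assms(2) by (simp add: dual_comp_def)
  interpret \<phi>': Vector_Spaces.linear scale "(*)" \<phi>' using assms(3) by (simp add: dual_comp_def)
  fix v
  have "v \<in> span (\<Union>\<mu>. V \<mu>)"
    using span_components by simp
  then show "\<phi> v = \<phi>' v"
  proof (induction rule: span_induct_alt)
    case (step c x y)
    then obtain \<mu> where "x \<in> V \<mu>" by auto
    then have "\<phi> x = \<phi>' x"
      using assms(2,3) eq by (cases "\<mu> = \<kappa>") (auto simp: dual_comp_def)
    with step show ?case
      by (simp add: \<phi>.add \<phi>'.add \<phi>.scale \<phi>'.scale)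
  qed (simp add: \<phi>.zero \<phi>'.zero)
qed

lemma dual_comp_bij:
  assumes "graded_space scale UNIV V"
  shows "bij_betw (\<lambda>\<phi>. restrict \<phi> (V \<kappa>)) (dual_comp scale V \<kappa>)
     {\<psi> \<in> extensional (V \<kappa>). (\<forall>x\<in>V \<kappa>. \<forall>y\<in>V \<kappa>. \<psi> (x + y) = \<psi> x + \<psi> y) \<and>
        (\<forall>c. \<forall>x\<in>V \<kappa>. \<psi> (scale c x) = c * \<psi> x)}"
    (is "bij_betw ?r ?D ?H")
proof -
  interpret graded_space scale UNIV V by fact
  have "inj_on ?r ?D"
    by (intro inj_onI dual_comp_eqI[OF assms, of _ \<kappa>]) (auto dest: restrict_apply' fun_cong
        simp: restrict_def fun_eq_iff split: if_splits)
  moreover have "?r ` ?D \<subseteq> ?H"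
  proof (intro image_subsetI)
    fix \<phi> assume "\<phi> \<in> ?D"
    then interpret \<phi>: Vector_Spaces.linear scale "(*)" \<phi> by (simp add: dual_comp_def)
    show "?r \<phi> \<in> ?H"
      by (auto simp: \<phi>.add \<phi>.scale subspace_add[OF subspace_component]
          subspace_scale[OF subspace_component])
  qed
  moreover have "?H \<subseteq> ?r ` ?D"
  proof
    fix \<psi> assume H: "\<psi> \<in> ?H"
    then obtain \<phi> where \<phi>: "\<phi> \<in> ?D" "\<forall>x\<in>V \<kappa>. \<phi> x = \<psi> x"
      using linear_functional_extension[of \<kappa> \<psi>] by auto
    then have "?r \<phi> = \<psi>"
      using H by (intro extensionalityI[of _ "V \<kappa>"]) auto
    with \<phi> show "\<psi> \<in> ?r ` ?D" by blast
  qed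
  ultimately show ?thesis
    by (auto simp: bij_betw_def)
qed

lemma pre_perfect_space_graded_dual:
  fixes scale :: "'k::field \<Rightarrow> 'v::ab_group_add \<Rightarrow> 'v"
  assumes "pre_dual_perfect_space I A \<alpha> h scale V f"
  shows "pre_perfect_space I A \<alpha> h dual_scale (graded_dual scale V) (dual_comp scale V)
           (\<lambda>i. transpose_op (f i))"
proof -
  interpret pre_dual_perfect_space I A \<alpha> h scale V f by fact
  interpret D: vector_space "dual_scale :: 'k \<Rightarrow> ('v \<Rightarrow> 'k) \<Rightarrow> 'v \<Rightarrow> 'k"
    by (rule vector_space_dual_scale)
  have gs: "graded_space scale UNIV V" ..
  have weight: "transpose_op (f i) \<phi> \<in> dual_comp scale V (\<mu> + \<alpha> i)"
    if i: "i \<in> I" and \<phi>: "\<phi> \<in> dual_comp scale V \<mu>" for i \<phi> \<mu>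
  proof -
    have "Vector_Spaces.linear scale (*) (\<phi> \<circ> f i)"
      using linear_f[OF i] \<phi> by (auto simp: dual_comp_def intro: Vector_Spaces.linear_compose)
    moreover have "\<phi> (f i v) = 0" if "\<nu> \<noteq> \<mu> + \<alpha> i" "v \<in> V \<nu>" for \<nu> v
    proof -
      have "f i v \<in> V (\<nu> - \<alpha> i)" "\<nu> - \<alpha> i \<noteq> \<mu>"
        using f_weight[OF i] that by (auto simp: algebra_simps)
      then show ?thesis
        using \<phi> by (auto simp: dual_comp_def)
    qed
    ultimately show ?thesis
      by (auto simp: dual_comp_def transpose_op_def)
  qed
  have module_mult: "module ((*) :: 'k \<Rightarrow> 'k \<Rightarrow> 'k)"
    by unfold_locales (simp_all add: algebra_simps)
  have subspace: "D.subspace (dual_comp scale V \<mu>)" for \<mu>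
    unfolding D.subspace_def dual_comp_def
    using module_axioms module_mult
    by (auto simp: dual_scale_def zero_fun_def plus_fun_def linear_iff_module_hom
        module_hom_iff algebra_simps)
  have zero: "dual_comp scale V \<mu> = {0}" if "V \<mu> = {0}" for \<mu>
  proof -
    have "\<phi> = 0" if "\<phi> \<in> dual_comp scale V \<mu>" for \<phi>
    proof (rule dual_comp_eqI[OF gs that D.subspace_0[OF subspace]])
      interpret Vector_Spaces.linear scale "(*)" \<phi> using that by (simp add: dual_comp_def)
      fix x assume "x \<in> V \<mu>"
      then show "\<phi> x = 0 x" using \<open>V \<mu> = {0}\<close> zero by simp
    qed
    then show ?thesis using D.subspace_0[OF subspace] by blast
  qed
  have add: "transpose_op g (\<phi> + \<psi>) = transpose_op g \<phi> + transpose_op g \<psi>"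
    and scale: "transpose_op g (dual_scale c \<phi>) = dual_scale c (transpose_op g \<phi>)"
    for g :: "'v \<Rightarrow> 'v" and \<phi> \<psi> :: "'v \<Rightarrow> 'k" and c
    by (auto simp: transpose_op_def dual_scale_def fun_eq_iff)
  show ?thesis
  proof unfold_locales
    fix S and x :: "_ \<Rightarrow> 'v \<Rightarrow> 'k" and \<mu>
    assume S: "finite S" and x: "\<And>\<mu>. \<mu> \<in> S \<Longrightarrow> x \<mu> \<in> dual_comp scale V \<mu>"
      and sum: "(\<Sum>\<mu>\<in>S. x \<mu>) = 0" and \<mu>: "\<mu> \<in> S"
    show "x \<mu> = 0"
    proof (rule dual_comp_eqI[OF gs x[OF \<mu>] D.subspace_0[OF subspace]])
      fix v assume v: "v \<in> V \<mu>"
      have "(\<Sum>\<nu>\<in>T. x \<nu>) v = (\<Sum>\<nu>\<in>T. x \<nu> v)" for T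
        by (induction T rule: infinite_finite_induct) auto
      then have "0 = (\<Sum>\<nu>\<in>S. x \<nu> v)"
        using sum by (metis zero_fun_def)
      also have "\<dots> = (\<Sum>\<nu>\<in>{\<mu>}. x \<nu> v)"
      proof (intro sum.mono_neutral_right ballI)
        fix \<nu> assume "\<nu> \<in> S - {\<mu>}"
        then have "x \<nu> \<in> dual_comp scale V \<nu>" "\<mu> \<noteq> \<nu>"
          using x by auto
        then show "x \<nu> v = 0"
          using v by (auto simp: dual_comp_def)
      qed (use S \<mu> in auto)
      finally show "x \<mu> v = 0 v" by simp
    qed
  next
    have "weights (dual_comp scale V) \<subseteq> weights V"
      using zero by (auto simp: weights_def)
    then show "weights_bounded I \<alpha> (dual_comp scale V)"
      using bounded unfolding weights_bounded_def by (meson subset_trans)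
  next
    fix i assume i: "i \<in> I"
    show "transpose_op (f i) \<in> graded_dual scale V \<rightarrow> graded_dual scale V"
    proof
      fix \<phi> assume "\<phi> \<in> graded_dual scale V"
      then show "transpose_op (f i) \<phi> \<in> graded_dual scale V"
        unfolding graded_dual_def
      proof (induction rule: D.span_induct_alt)
        case base
        have "transpose_op (f i) (0 :: 'v \<Rightarrow> 'k) = 0"
          by (simp add: transpose_op_def fun_eq_iff)
        then show ?case using D.span_zero by metis
      next
        case (step c x y)
        then have "transpose_op (f i) x \<in> D.span (\<Union>\<kappa>. dual_comp scale V \<kappa>)"
          using weight[OF i] by (blast intro: D.span_base)
        with step show ?case
          unfolding add scale by (intro D.span_add D.span_scale)
      qed
    qed
  qed (use subspace weight in \<open>auto simp: graded_dual_def add scale\<close>)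
qed

end

theory Submission
  imports Defs
begin

text \<open>
  Write \<open>R n\<close> for the image of \<open>f\<^sub>i\<^sup>n\<close>; its annihilator in the graded dual is the kernel of
  \<open>e\<^sub>i\<^sup>n\<close>. Both perfectness conditions force \<open>B\<close> to be adapted to the filtration: every \<open>R n\<close> is
  spanned by \<open>B \<inter> R n\<close>. On the side of \<open>V\<close>, condition (b) gives \<open>R m = span (B \<inter> R m) + R (m + 1)\<close>
  by induction on \<open>m\<close>, and iterating this suffices because each coordinate functional kills \<open>R n\<close>
  for large \<open>n\<close> (the weights are bounded above). On the dual side, the kernel of \<open>e\<^sub>i\<^sup>n\<close> is spanned
  by the part of the dual basis it contains, and \<open>R n\<close> is recovered as the annihilator of this
  kernel since it is graded. For an adapted basis, \<open>\<ell>\<^sub>i(b)\<close> and \<open>\<ell>\<^sub>i\<^sup>\<or>(b\<^sup>\<or>)\<close> both equal the largest \<open>n\<close> with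
  \<open>b \<in> R n\<close>, and both perfectness conditions say that the matrix of \<open>f\<^sub>i\<close> is, on the graded
  pieces of the filtration, a partial permutation matrix up to nonzero scalars.
\<close>

text \<open>This turns spans of parts of the basis into vanishing conditions on coordinates.
  Adaptedness, condition (b) and the transfer of homogeneity are all checked in that form.\<close>

lemma (in vector_space) mem_span_subset_basis_iff:
  assumes B: "is_basis scale UNIV B" and S: "S \<subseteq> B"
  shows "v \<in> span S \<longleftrightarrow> (\<forall>b\<in>B - S. dual_vector scale B b v = 0)"
proof
  assume v: "v \<in> span S"
  show "\<forall>b\<in>B - S. dual_vector scale B b v = 0"
  proof
    fix b assume b: "b \<in> B - S"
    interpret d: Vector_Spaces.linear scale "(*)" "dual_vector scale B b"
      using dual_vector(1)[OF vector_space_axioms B] b by simp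
    show "dual_vector scale B b v = 0"
      using v by (rule d.eq_0_on_span[rotated]) (use dual_vector(2)[OF vector_space_axioms B] b S in auto)
  qed
next
  assume *: "\<forall>b\<in>B - S. dual_vector scale B b v = 0"
  have ind: "independent B" and span: "span B = UNIV"
    using B by (auto simp: is_basis_def)
  have "b \<in> S" if b: "representation B v b \<noteq> 0" for b
  proof (rule ccontr)
    assume "b \<notin> S"
    moreover have "b \<in> B" using representation_ne_zero[OF b] .
    moreover have "b \<noteq> 0" using \<open>b \<in> B\<close> ind dependent_zero by auto
    moreover have "dual_vector scale B b v = representation B v b"
      using \<open>b \<noteq> 0\<close> by (simp add: dual_vector_def)
    ultimately show False using * b by simp
  qed
  then have "(\<Sum>b | representation B v b \<noteq> 0. scale (representation B v b) b) \<in> span S"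
    by (intro span_sum span_scale span_base) auto
  then show "v \<in> span S"
    using sum_nonzero_representation_eq[OF ind, of v] span by simp
qed


section \<open>A single operator and its transpose\<close>

text \<open>The grading is abstracted away: \<open>W\<close> stands for the graded dual, and
  \<open>nilpotent\<close> records what boundedness of the weights supplies for a homogeneous
  basis.\<close>

locale transposed_operator = vector_space scale
  for scale :: "'k::field \<Rightarrow> 'v::ab_group_add \<Rightarrow> 'v" +
  fixes B :: "'v set" and W :: "('v \<Rightarrow> 'k) set" and g :: "'v \<Rightarrow> 'v"
  assumes basis: "is_basis scale UNIV B"
    and linear_g: "Vector_Spaces.linear scale scale g"
    and subspace_W: "module.subspace dual_scale W"
    and transpose_W: "\<phi> \<in> W \<Longrightarrow> transpose_op g \<phi> \<in> W"
    and dual_W: "b \<in> B \<Longrightarrow> dual_vector scale B b \<in> W"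
    and nilpotent: "b \<in> B \<Longrightarrow> \<exists>n. (transpose_op g ^^ n) (dual_vector scale B b) = 0"
begin

interpretation D: vector_space "dual_scale :: 'k \<Rightarrow> ('v \<Rightarrow> 'k) \<Rightarrow> 'v \<Rightarrow> 'k"
  by (rule vector_space_dual_scale)

interpretation g: Vector_Spaces.linear scale scale g
  by (rule linear_g)

abbreviation R :: "nat \<Rightarrow> 'v set" where
  "R n \<equiv> range (g ^^ n)"

abbreviation e :: "('v \<Rightarrow> 'k) \<Rightarrow> 'v \<Rightarrow> 'k" where
  "e \<equiv> transpose_op g"

abbreviation coord :: "'v \<Rightarrow> 'v \<Rightarrow> 'k" where
  "coord \<equiv> dual_vector scale B"

section \<open>Coordinate functionals of the basis\<close>

lemma linear_coord: "b \<in> B \<Longrightarrow> Vector_Spaces.linear scale (*) (coord b)"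
  by (rule dual_vector(1)[OF vector_space_axioms basis])

lemma coord_basis: "b \<in> B \<Longrightarrow> b' \<in> B \<Longrightarrow> coord b b' = (if b = b' then 1 else 0)"
  by (rule dual_vector(2)[OF vector_space_axioms basis])

lemma coord_diff: "b \<in> B \<Longrightarrow> coord b (x - y) = coord b x - coord b y"
  using Vector_Spaces.linear.axioms(3)[OF linear_coord] module_hom.diff by blast

lemma coord_add: "b \<in> B \<Longrightarrow> coord b (x + y) = coord b x + coord b y"
  using Vector_Spaces.linear.axioms(3)[OF linear_coord] module_hom.add by blast

lemma coord_scale: "b \<in> B \<Longrightarrow> coord b (scale c x) = c * coord b x"
  using Vector_Spaces.linear.axioms(3)[OF linear_coord] module_hom.scale by blast

lemma coord_eq_0_on_span:
  "b \<in> B \<Longrightarrow> (\<And>x. x \<in> X \<Longrightarrow> coord b x = 0) \<Longrightarrow> x \<in> span X \<Longrightarrow> coord b x = 0"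
  using Vector_Spaces.linear.axioms(3)[OF linear_coord] module_hom.eq_0_on_span by blast

lemma coord_zero: "coord 0 = 0"
  by (simp add: dual_vector_def)

lemma zero_notin_basis: "0 \<notin> B"
  using basis dependent_zero by (auto simp: is_basis_def)

lemma coord_nonzero: "b \<in> B \<Longrightarrow> coord b \<noteq> 0"
  using coord_basis[of b b] by (metis zero_fun_def zero_neq_one)

lemma coord_inject: "b \<in> B \<Longrightarrow> b' \<in> B \<Longrightarrow> coord b = coord b' \<longleftrightarrow> b = b'"
  using coord_basis[of b b] coord_basis[of b' b] by (metis zero_neq_one)

lemma inj_on_coord: "inj_on coord B"
  by (simp add: inj_on_def coord_inject)

section \<open>The decreasing filtration by images of powers, and its annihilators\<close>

lemma linear_funpow: "Vector_Spaces.linear scale scale (g ^^ n)"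
proof (induction n)
  case 0
  show ?case using linear_id by (simp add: id_def)
next
  case (Suc n)
  then show ?case
    unfolding funpow.simps by (rule Vector_Spaces.linear_compose[OF _ linear_g])
qed

lemma subspace_R: "subspace (R n)"
  using Vector_Spaces.linear.axioms(3)[OF linear_funpow] module_hom.subspace_image subspace_UNIV
  by blast

lemma R_Suc: "R (Suc n) = g ` R n"
  by (auto simp: image_image)

lemma R_Suc_subset: "R (Suc n) \<subseteq> R n"
  by (auto simp: funpow_Suc_right simp del: funpow.simps)

lemma R_antimono: "m \<le> n \<Longrightarrow> R n \<subseteq> R m"
  using lift_Suc_antimono_le[of R] R_Suc_subset by blast

lemma transpose_funpow: "(e ^^ n) \<phi> = \<phi> \<circ> (g ^^ n)"
proof (induction n)
  case (Suc n)
  then show ?case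
    unfolding funpow_Suc_right[of n g] by (simp add: transpose_op_def comp_assoc)
qed simp

lemma transpose_funpow_eq_0_iff: "(e ^^ n) \<phi> = 0 \<longleftrightarrow> (\<forall>x\<in>R n. \<phi> x = 0)"
  by (auto simp: transpose_funpow fun_eq_iff)

lemma transpose_funpow_mono: "(e ^^ m) \<phi> = 0 \<Longrightarrow> m \<le> n \<Longrightarrow> (e ^^ n) \<phi> = 0"
  unfolding transpose_funpow_eq_0_iff using R_antimono[of m n] by blast

text \<open>With \<open>n\<close> one less than the level of \<phi>, the left side is the
  approximation condition of a perfect map. It thus compares \<phi> after \<open>g\<close> with a
  multiple of \<psi> on \<open>R n\<close> only.\<close>

lemma transpose_diff_kernel_iff:
  "(e ^^ n) (e \<phi> - dual_scale c \<psi>) = 0 \<longleftrightarrow> (\<forall>x\<in>R n. \<phi> (g x) = c * \<psi> x)"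
  by (simp add: transpose_funpow_eq_0_iff transpose_op_def dual_scale_def)

text \<open>Since \<open>coord b\<close> takes the value 1 at \<open>b\<close>, a power of
  \<open>e\<close> killing it keeps \<open>b\<close> out of some \<open>R N\<close>. The images
  decrease, so there is exactly one place where \<open>b\<close> drops out, and the definite
  description in \<open>ell\<close> denotes it.\<close>

lemma mem_R_iff:
  assumes b: "b \<in> B"
  shows "b \<in> R n \<longleftrightarrow> n \<le> ell g b"
proof -
  obtain N where "(e ^^ N) (coord b) = 0" using nilpotent[OF b] by blast
  then have N: "b \<notin> R N"
    using coord_basis[OF b b] unfolding transpose_funpow_eq_0_iff by fastforce
  have "b \<in> R 0" by simp
  with N obtain k where k: "b \<in> R k" "b \<notin> R (Suc k)"
    using ex_least_nat_less[of "\<lambda>n. b \<notin> R n" N] by blast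
  have iff: "b \<in> R n \<longleftrightarrow> n \<le> k" for n
    using k R_antimono[of n k] R_antimono[of "Suc k" n] by (cases "n \<le> k") auto
  have "ell g b = k"
    unfolding ell_def
  proof (rule the_equality)
    show "n = k" if "b \<in> R n - R (Suc n)" for n
      using that unfolding Diff_iff iff by simp
  qed (use k in blast)
  with iff show ?thesis by simp
qed

text \<open>The set of exponents not killing \<open>coord b\<close> contains 0, is bounded by
  nilpotency and is closed downwards, so it consists of all \<open>n\<close> up to its
  maximum.\<close>

lemma ell_check_iff:
  assumes b: "b \<in> B"
  shows "(e ^^ n) (coord b) \<noteq> 0 \<longleftrightarrow> n \<le> ell_check e (coord b)"
proof -
  let ?N = "{n. (e ^^ n) (coord b) \<noteq> 0}"
  obtain N where N: "(e ^^ N) (coord b) = 0" using nilpotent[OF b] by blast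
  have "?N \<subseteq> {..<N}"
    using transpose_funpow_mono[OF N] by (auto simp: not_less[symmetric])
  then have fin: "finite ?N" by (rule finite_subset) simp
  have "0 \<in> ?N" using coord_nonzero[OF b] by simp
  then have "Max ?N \<in> ?N" using fin Max_in by blast
  then have "(e ^^ n) (coord b) \<noteq> 0" if "n \<le> Max ?N"
    using transpose_funpow_mono[of n "coord b" "Max ?N"] that by blast
  moreover have "n \<le> Max ?N" if "(e ^^ n) (coord b) \<noteq> 0"
    using fin that by (intro Max_ge) auto
  ultimately show ?thesis unfolding ell_check_def by blast
qed

section \<open>Bases adapted to the filtration\<close>

text \<open>One inclusion suffices: the span lies in \<open>R n\<close> because \<open>R n\<close>
  is a subspace.\<close>

definition adapted :: bool where
  "adapted \<longleftrightarrow> (\<forall>n. R n \<subseteq> span (B \<inter> R n))"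

text \<open>\<open>R n\<close> lies in the span of the basis vectors it contains exactly when every
  other coordinate vanishes on \<open>R n\<close>, that is, lies in the kernel of the
  \<open>n\<close>-th power of \<open>e\<close>. This is the formulation shared by both sides of the
  duality.\<close>

lemma adapted_iff: "adapted \<longleftrightarrow> (\<forall>n. \<forall>b\<in>B - R n. (e ^^ n) (coord b) = 0)"
proof -
  have "x \<in> span (B \<inter> R n) \<longleftrightarrow> (\<forall>b\<in>B - R n. coord b x = 0)" for n x
    unfolding mem_span_subset_basis_iff[OF basis Int_lower1] by auto
  then show ?thesis
    unfolding adapted_def transpose_funpow_eq_0_iff subset_iff by blast
qed

lemma adaptedI_dual_perfect_map:
  assumes F: "dual_perfect_map scale g B F"
  shows adapted
proof -
  \<comment> \<open>As \<open>m\<close> is at most \<open>ell g b\<close>, the error in condition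
    (b) lies in \<open>R (m + 2)\<close>. Subtracting it from \<open>g b\<close> and dividing by
    \<open>c\<close> puts \<open>F b\<close> into \<open>R (m + 1)\<close>.\<close>
  have g_basis: "g b \<in> span (B \<inter> R (Suc m) \<union> R (Suc (Suc m)))" if b: "b \<in> B \<inter> R m" for b m
  proof -
    obtain c where c: "c \<noteq> 0" and "g b - scale c (F b) \<in> R (ell g b + 2)"
      using F b unfolding dual_perfect_map_def by blast
    moreover have "m \<le> ell g b" using b mem_R_iff by blast
    ultimately have r: "g b - scale c (F b) \<in> R (Suc (Suc m))"
      using R_antimono[of "Suc (Suc m)" "ell g b + 2"] by auto
    then have r': "g b - scale c (F b) \<in> R (Suc m)"
      using R_Suc_subset by blast
    have "g b \<in> R (Suc m)" using b unfolding R_Suc by blast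
    from subspace_diff[OF subspace_R this r'] have "scale c (F b) \<in> R (Suc m)"
      by simp
    then have "scale (inverse c) (scale c (F b)) \<in> R (Suc m)"
      using subspace_scale[OF subspace_R] by blast
    then have "F b \<in> R (Suc m)" using c by simp
    moreover have "F b \<in> B \<union> {0}"
      using F b by (auto simp: dual_perfect_map_def)
    ultimately have "F b \<in> span (B \<inter> R (Suc m) \<union> R (Suc (Suc m)))"
      using span_zero by (auto intro: span_base)
    then have "scale c (F b) + (g b - scale c (F b)) \<in> span (B \<inter> R (Suc m) \<union> R (Suc (Suc m)))"
      using r by (intro span_add span_scale) (auto intro: span_base)
    then show ?thesis by simp
  qed
  have step: "R m \<subseteq> span (B \<inter> R m \<union> R (Suc m))" for m
  proof (induction m)
    case 0
    show ?case using basis span_mono[of B "B \<union> R (Suc 0)"] by (auto simp: is_basis_def)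
  next
    case (Suc m)
    have "R (Suc m) \<subseteq> g ` span (B \<inter> R m \<union> R (Suc m))"
      using Suc unfolding R_Suc by blast
    also have "\<dots> = span (g ` (B \<inter> R m) \<union> R (Suc (Suc m)))"
      by (simp only: g.span_image[symmetric] image_Un R_Suc)
    also have "\<dots> \<subseteq> span (B \<inter> R (Suc m) \<union> R (Suc (Suc m)))"
      using g_basis by (intro span_minimal) (auto intro: span_base)
    finally show ?case .
  qed
  have iterate: "R n \<subseteq> span (B \<inter> R n \<union> R (n + k))" for n k
  proof (induction k)
    case 0
    show ?case by (auto intro: span_base)
  next
    case (Suc k)
    have "R (n + k) \<subseteq> span (B \<inter> R n \<union> R (n + Suc k))"
    proof -
      have "B \<inter> R (n + k) \<union> R (Suc (n + k)) \<subseteq> B \<inter> R n \<union> R (n + Suc k)"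
        using R_antimono[of n "n + k"] by auto
      then show ?thesis using step[of "n + k"] span_mono by blast
    qed
    then have "span (B \<inter> R n \<union> R (n + k)) \<subseteq> span (B \<inter> R n \<union> R (n + Suc k))"
      by (intro span_minimal) (auto intro: span_base)
    with Suc show ?case by blast
  qed
  show adapted
    unfolding adapted_iff transpose_funpow_eq_0_iff
  proof (intro allI ballI)
    fix n b x assume b: "b \<in> B - R n" and x: "x \<in> R n"
    obtain N where N: "(e ^^ N) (coord b) = 0" using nilpotent b by blast
    \<comment> \<open>Take \<open>k = N\<close> in \<open>iterate\<close>: \<open>coord b\<close>
      kills the remainder in \<open>R (n + N)\<close>, and also every basis vector in
      \<open>R n\<close>, because \<open>b\<close> is not among them.\<close>
    have "(e ^^ (n + N)) (coord b) = 0"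
      using transpose_funpow_mono[OF N] by simp
    then have "coord b y = 0" if "y \<in> B \<inter> R n \<union> R (n + N)" for y
      using that b coord_basis[of b y] by (auto simp: transpose_funpow_eq_0_iff)
    then show "coord b x = 0"
      using coord_eq_0_on_span[of b "B \<inter> R n \<union> R (n + N)" x] b iterate[of n N] x by blast
  qed
qed

text \<open>If \<open>b\<close> lies in \<open>R n\<close>, then \<open>coord b\<close> is nonzero
  there, as its value at \<open>b\<close> is 1; if not, adaptedness makes it vanish on
  \<open>R n\<close>. So both levels bound the same set of exponents.\<close>

lemma ell_eq_ell_check:
  assumes adapted and b: "b \<in> B"
  shows "ell g b = ell_check e (coord b)"
proof -
  have "b \<in> R n \<longleftrightarrow> (e ^^ n) (coord b) \<noteq> 0" for n
    using assms coord_basis[OF b b] by (fastforce simp: adapted_iff transpose_funpow_eq_0_iff)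
  then have "n \<le> ell g b \<longleftrightarrow> n \<le> ell_check e (coord b)" for n
    using mem_R_iff[OF b] ell_check_iff[OF b] by blast
  then show ?thesis by (meson order_antisym order_refl)
qed

section \<open>Consequences of a perfect map on the dual basis\<close>

context
  fixes E
  assumes E: "perfect_map dual_scale W e (coord ` B) E"
begin

text \<open>The approximation condition says that \<open>e (coord b)\<close> and \<open>c\<close>
  times \<open>coord b'\<close> agree on \<open>R m\<close>. For \<open>n\<close> at least
  \<open>m\<close> they therefore vanish on \<open>R n\<close> together, which fixes the level of
  \<open>coord b'\<close>.\<close>

lemma perfect_map_step:
  assumes b: "b \<in> B" and m: "ell_check e (coord b) = Suc m"
  obtains b' c where "b' \<in> B" "E (coord b) = coord b'" "c \<noteq> 0"
    "\<And>x. x \<in> R m \<Longrightarrow> coord b (g x) = c * coord b' x" "ell_check e (coord b') = m"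
proof -
  have "ell_check e (coord b) > 0" using m by simp
  then have "E (coord b) \<in> coord ` B \<and> (\<exists>c. c \<noteq> 0 \<and>
      e (coord b) - dual_scale c (E (coord b)) \<in> {w \<in> W. (e ^^ (ell_check e (coord b) - 1)) w = 0})"
    using E b unfolding perfect_map_def by blast
  then obtain c where c: "E (coord b) \<in> coord ` B" "c \<noteq> 0"
    "(e ^^ m) (e (coord b) - dual_scale c (E (coord b))) = 0"
    unfolding m by auto
  then obtain b' where b': "b' \<in> B" "E (coord b) = coord b'" by blast
  have eq: "coord b (g x) = c * coord b' x" if "x \<in> R m" for x
    using c(3)[unfolded b'(2) transpose_diff_kernel_iff] that by (rule bspec)
  have *: "(e ^^ n) (coord b') = 0 \<longleftrightarrow> (e ^^ Suc n) (coord b) = 0" if "m \<le> n" for n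
  proof -
    have "(e ^^ Suc n) (coord b) = 0 \<longleftrightarrow> (\<forall>x\<in>R n. coord b (g x) = 0)"
      unfolding transpose_funpow_eq_0_iff R_Suc by blast
    also have "\<dots> \<longleftrightarrow> (\<forall>x\<in>R n. coord b' x = 0)"
      using eq c(2) R_antimono[OF that] by (simp add: subset_iff)
    finally show ?thesis unfolding transpose_funpow_eq_0_iff by blast
  qed
  have "n \<le> ell_check e (coord b') \<longleftrightarrow> n \<le> m" if "m \<le> n" for n
    using *[OF that] ell_check_iff[OF b, of "Suc n"] ell_check_iff[OF b'(1), of n]
    unfolding m Suc_le_mono by blast
  \<comment> \<open>The instance at \<open>m\<close> gives the lower bound, the one at
    \<open>Suc m\<close> the upper bound.\<close>
  from this[of m] this[of "Suc m"] have "ell_check e (coord b') = m"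
    by simp
  then show ?thesis using that[OF b' c(2) eq] by blast
qed

text \<open>The error made by one application of \<open>E\<close> lies in the kernel of the power of
  \<open>e\<close> still to be applied. Hence at the top power the approximation becomes an exact
  equality up to a nonzero scalar.\<close>

lemma perfect_map_funpow:
  assumes "b \<in> B" "ell_check e (coord b) = m"
  shows "\<exists>b'\<in>B. (E ^^ m) (coord b) = coord b' \<and>
    (\<exists>c. c \<noteq> 0 \<and> (\<forall>v. (e ^^ m) (coord b) v = c * coord b' v))"
  using assms
proof (induction m arbitrary: b)
  case 0
  then show ?case by (intro bexI[of _ b] conjI exI[of _ 1]) auto
next
  case (Suc m)
  obtain b1 c1 where b1: "b1 \<in> B" "E (coord b) = coord b1" "c1 \<noteq> 0"
    "\<And>x. x \<in> R m \<Longrightarrow> coord b (g x) = c1 * coord b1 x" "ell_check e (coord b1) = m"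
    using perfect_map_step[OF Suc.prems] by blast
  obtain b' c where b': "b' \<in> B" "(E ^^ m) (coord b1) = coord b'" "c \<noteq> 0"
    "\<And>v. (e ^^ m) (coord b1) v = c * coord b' v"
    using Suc.IH[OF b1(1,5)] by blast
  have "(e ^^ Suc m) (coord b) v = c1 * c * coord b' v" for v
    using b1(4)[of "(g ^^ m) v"] b'(4)[of v] by (simp add: transpose_funpow del: funpow.simps(2)) simp
  then show ?case
    using b' b1(2,3) by (intro bexI[of _ b'] conjI exI[of _ "c1 * c"])
      (auto simp: funpow_Suc_right simp del: funpow.simps)
qed

text \<open>All intermediate values are dual basis vectors, hence nonzero, so injectivity of
  \<open>E\<close> away from 0 can be used at every step.\<close>

lemma perfect_map_funpow_inj:
  assumes "b \<in> B" "ell_check e (coord b) = m" "b' \<in> B" "ell_check e (coord b') = m"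
    and "(E ^^ m) (coord b) = (E ^^ m) (coord b')"
  shows "b = b'"
  using assms
proof (induction m arbitrary: b b')
  case 0
  then show ?case by (simp add: coord_inject)
next
  case (Suc m)
  obtain b1 where b1: "b1 \<in> B" "E (coord b) = coord b1" "ell_check e (coord b1) = m"
    using perfect_map_step[OF Suc.prems(1,2)] by metis
  obtain b1' where b1': "b1' \<in> B" "E (coord b') = coord b1'" "ell_check e (coord b1') = m"
    using perfect_map_step[OF Suc.prems(3,4)] by metis
  have "b1 = b1'"
    using Suc.prems(5) b1 b1'
    by (intro Suc.IH) (auto simp: funpow_Suc_right simp del: funpow.simps)
  then have "E (coord b) = E (coord b')" "E (coord b) \<noteq> 0"
    using b1 b1' coord_nonzero by auto
  then have "coord b = coord b'"
    using E Suc.prems(1,3) unfolding perfect_map_def by blast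
  then show ?case using Suc.prems by (simp add: coord_inject)
qed

text \<open>
  The top layer of a combination cannot cancel: on it, a suitable power of \<^term>\<open>e\<close> acts, up to
  nonzero scalars, as an injection into the dual basis.
\<close>

lemma kernel_component:
  assumes T: "finite T" "T \<subseteq> B" and ker: "\<And>x. x \<in> R n \<Longrightarrow> (\<Sum>b\<in>T. r b * coord b x) = 0"
    and b: "b \<in> T" "r b \<noteq> 0"
  shows "(e ^^ n) (coord b) = 0"
proof (rule ccontr)
  assume nz: "(e ^^ n) (coord b) \<noteq> 0"
  let ?l = "\<lambda>b. ell_check e (coord b)"
  define S where "S = {b \<in> T. r b \<noteq> 0}"
  have S: "finite S" "b \<in> S" "S \<subseteq> T" using T b by (auto simp: S_def)
  \<comment> \<open>The top level among the terms with nonzero coefficient; it is at least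
    \<open>n\<close> because \<open>b\<close> is one of these terms.\<close>
  define m where "m = Max (?l ` S)"
  have "m \<in> ?l ` S" unfolding m_def using S by (intro Max_in) auto
  then obtain a where a: "a \<in> S" "?l a = m" by blast
  have le: "?l x \<le> m" if "x \<in> S" for x
    unfolding m_def using S that by (intro Max_ge) auto
  have "n \<le> m"
    using nz ell_check_iff[of b n] le[OF S(2)] S T by force
  have aB: "a \<in> B" using a S T by blast
  obtain a' c where a': "a' \<in> B" "(E ^^ m) (coord a) = coord a'" "c \<noteq> 0"
    "\<And>v. (e ^^ m) (coord a) v = c * coord a' v"
    using perfect_map_funpow[OF aB a(2)] by blast
  \<comment> \<open>Terms below the top level are killed by the \<open>m\<close>-th power of
    \<open>e\<close>; the other terms at the top level become multiples of coordinates different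
    from \<open>coord a'\<close>.\<close>
  have others: "(e ^^ m) (coord x) a' = 0" if x: "x \<in> S - {a}" for x
  proof (cases "?l x = m")
    case True
    have xB: "x \<in> B" using x S T by blast
    obtain x' d where x': "x' \<in> B" "(E ^^ m) (coord x) = coord x'"
      "\<And>v. (e ^^ m) (coord x) v = d * coord x' v"
      using perfect_map_funpow[OF xB True] by blast
    have "x' \<noteq> a'"
      using perfect_map_funpow_inj[OF xB True aB a(2)] x' a' x by auto
    then show ?thesis using x' a' by (simp add: coord_basis)
  next
    case False
    then have "\<not> m \<le> ?l x" using le x by force
    then have "(e ^^ m) (coord x) = 0" using ell_check_iff[of x m] x S T by blast
    then show ?thesis by simp
  qed
  \<comment> \<open>Evaluating the relation at this vector isolates the summand of \<open>a\<close>,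
    with value \<open>r a * c\<close>.\<close>
  have "(g ^^ m) a' \<in> R n" using R_antimono[OF \<open>n \<le> m\<close>] by blast
  from ker[OF this] have "0 = (\<Sum>x\<in>T. r x * (e ^^ m) (coord x) a')"
    by (simp add: transpose_funpow)
  also have "\<dots> = (\<Sum>x\<in>{a}. r x * (e ^^ m) (coord x) a')"
    using others a(1) T(1) by (intro sum.mono_neutral_right) (auto simp: S_def)
  also have "\<dots> = r a * c"
    using a' by (simp add: coord_basis)
  finally show False using a a' by (simp add: S_def)
qed

text \<open>A separating \<phi> is a combination of coordinates lying in the kernel, and its
  coefficient at \<open>coord b\<close> is the nonzero value of \<phi> at \<open>b\<close>. By
  \<open>kernel_component\<close>, \<open>coord b\<close> itself lies in the kernel.\<close>

lemma adaptedI_perfect_map: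
  assumes sep: "\<And>n b. b \<in> B \<Longrightarrow> b \<notin> R n \<Longrightarrow>
      \<exists>\<phi>\<in>module.span dual_scale (coord ` B). (\<forall>x\<in>R n. \<phi> x = 0) \<and> \<phi> b \<noteq> 0"
  shows adapted
  unfolding adapted_iff
proof (intro allI ballI)
  fix n b assume b: "b \<in> B - R n"
  then obtain \<phi> where \<phi>: "\<phi> \<in> D.span (coord ` B)" "\<forall>x\<in>R n. \<phi> x = 0" "\<phi> b \<noteq> 0"
    using sep by blast
  from \<phi>(1) obtain T r where T: "finite T" "T \<subseteq> coord ` B" "\<phi> = (\<Sum>\<psi>\<in>T. dual_scale (r \<psi>) \<psi>)"
    unfolding D.span_explicit by blast
  obtain U where U: "finite U" "U \<subseteq> B" "T = coord ` U"
    using finite_subset_image[OF T(1,2)] by blast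
  have "\<phi> = (\<Sum>x\<in>U. dual_scale (r (coord x)) (coord x))"
    unfolding T(3) U(3) using inj_on_subset[OF inj_on_coord U(2)] by (subst sum.reindex) auto
  moreover have "(\<Sum>x\<in>X. dual_scale (r (coord x)) (coord x)) v = (\<Sum>x\<in>X. r (coord x) * coord x v)"
    for X v
    by (induction X rule: infinite_finite_induct) (auto simp: dual_scale_def)
  ultimately have eq: "\<phi> v = (\<Sum>x\<in>U. r (coord x) * coord x v)" for v
    by simp
  have "\<phi> b = (\<Sum>x\<in>U. if x = b then r (coord b) else 0)"
    unfolding eq using U b by (intro sum.cong) (auto simp: coord_basis)
  then have "b \<in> U" "r (coord b) \<noteq> 0"
    using \<phi>(3) U(1) by (auto split: if_splits)
  then show "(e ^^ n) (coord b) = 0"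
    using \<phi>(2) U by (intro kernel_component[of U n "\<lambda>x. r (coord x)"]) (auto simp: eq)
qed

text \<open>The witness is the partial inverse of \<open>E\<close>, carried over to
  \<open>B\<close>. For the approximation condition it suffices that the error has zero coordinate
  at each basis vector outside \<open>R (ell g b + 2)\<close>.\<close>

lemma dual_perfect_map_exists:
  assumes adapted
  shows "\<exists>F. dual_perfect_map scale g B F"
proof
  define F where
    "F b = (if coord b \<in> E ` coord ` B then inv_into B (E \<circ> coord) (coord b) else 0)" for b
  have inj: "b1 = b2" if "b1 \<in> B" "b2 \<in> B" "E (coord b1) = E (coord b2)" "E (coord b1) \<noteq> 0" for b1 b2
  proof -
    have "coord b1 = coord b2"
      using E that unfolding perfect_map_def by blast
    with that show ?thesis by (simp add: coord_inject)
  qed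
  have F_B: "F b \<in> B \<and> E (coord (F b)) = coord b" if "coord b \<in> E ` coord ` B" for b
    using that f_inv_into_f[of "coord b" "E \<circ> coord" B] inv_into_into[of "coord b" "E \<circ> coord" B]
    by (simp add: F_def image_comp)
  have F_iff: "F b = b' \<longleftrightarrow> E (coord b') = coord b" if "b \<in> B" "b' \<in> B" for b b'
  proof
    assume "F b = b'"
    then have "coord b \<in> E ` coord ` B"
      using that zero_notin_basis by (auto simp: F_def split: if_splits)
    with \<open>F b = b'\<close> F_B show "E (coord b') = coord b" by blast
  next
    assume *: "E (coord b') = coord b"
    then have "coord b \<in> E ` coord ` B" using that by (metis image_eqI)
    with F_B inj[of "F b" b'] * coord_nonzero that show "F b = b'" by auto
  qed
  have pos: "\<exists>m. ell_check e (coord b') = Suc m" if "b \<in> B" "b' \<in> B" "F b = b'" for b b'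
  proof (rule ccontr)
    assume "\<not> ?thesis"
    then have "ell_check e (coord b') = 0" by (cases "ell_check e (coord b')") auto
    then have "E (coord b') = 0" using E that unfolding perfect_map_def by blast
    then show False using F_iff that coord_nonzero by auto
  qed
  have F_approx: "\<exists>c. c \<noteq> 0 \<and> g b - scale c (F b) \<in> R (ell g b + 2)" if b: "b \<in> B" for b
  proof -
    \<comment> \<open>The scalar is the one that \<open>E\<close> provides at
      \<open>coord (F b)\<close>. If \<open>F b\<close> is 0, any nonzero scalar serves, and 1 is
      chosen.\<close>
    obtain c where c: "c \<noteq> 0"
      "F b \<in> B \<Longrightarrow> \<exists>m. ell_check e (coord (F b)) = Suc m \<and>
         (\<forall>x\<in>R m. coord (F b) (g x) = c * E (coord (F b)) x)"
    proof (cases "F b \<in> B")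
      case True
      with pos[OF b True] obtain m where m: "ell_check e (coord (F b)) = Suc m" by blast
      with perfect_map_step[OF True this] that show ?thesis by metis
    qed (use that[of 1] in simp)
    have "coord b' (g b - scale c (F b)) = 0" if b': "b' \<in> B - R (ell g b + 2)" for b'
    proof -
      \<comment> \<open>A vector \<open>b'\<close> outside \<open>R (ell g b + 2)\<close> has level
        at most \<open>ell g b + 1\<close>. So \<open>b\<close> lies in the image on which the
        relation for \<open>coord b'\<close> holds, and that relation can be evaluated at
        \<open>b\<close>.\<close>
      have le: "ell_check e (coord b') \<le> Suc (ell g b)"
      proof -
        have "\<not> ell g b + 2 \<le> ell g b'" using b' mem_R_iff by blast
        then show ?thesis using ell_eq_ell_check[OF \<open>adapted\<close>, of b'] b' by simp
      qed
      have bR: "b \<in> R m" if "ell_check e (coord b') = Suc m" for m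
        using le that mem_R_iff[OF b] by simp
      \<comment> \<open>The instance of \<open>coord_diff\<close> at zero arguments yields
        \<open>coord b' 0 = 0\<close>, for the case that \<open>F b\<close> is 0.\<close>
      have F_coord: "coord b' (F b) = (if F b = b' then 1 else 0)"
        using b' coord_basis[of b' "F b"] F_B[of b] coord_diff[of b' 0 0] zero_notin_basis
        by (auto simp: F_def)
      show ?thesis
      proof (cases "F b = b'")
        case True
        then obtain m where m: "ell_check e (coord b') = Suc m"
          "\<forall>x\<in>R m. coord b' (g x) = c * E (coord b') x"
          using c(2) b' by auto
        have "E (coord b') = coord b" using True F_iff b b' by blast
        then have "coord b' (g b) = c"
          using bspec[OF m(2) bR[OF m(1)]] b by (simp add: coord_basis)
        then show ?thesis using b' F_coord True by (simp add: coord_diff coord_scale)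
      next
        case False
        have "coord b' (g b) = 0"
        proof (cases "ell_check e (coord b')")
          case 0
          then have "(e ^^ 1) (coord b') = 0"
            using ell_check_iff[of b' 1] b' by simp
          then show ?thesis by (auto simp: transpose_op_def fun_eq_iff)
        next
          case (Suc m)
          obtain b1 c1 where b1: "b1 \<in> B" "E (coord b') = coord b1"
            "\<And>x. x \<in> R m \<Longrightarrow> coord b' (g x) = c1 * coord b1 x"
            using perfect_map_step[OF _ Suc] b' by blast
          have "b1 \<noteq> b" using False F_iff b b' b1 by blast
          then show ?thesis using b1 bR[OF Suc] b by (simp add: coord_basis)
        qed
        then show ?thesis using b' F_coord False by (simp add: coord_diff coord_scale)
      qed
    qed
    then have "g b - scale c (F b) \<in> span (B \<inter> R (ell g b + 2))"
      unfolding mem_span_subset_basis_iff[OF basis Int_lower1] by blast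
    also have "\<dots> \<subseteq> R (ell g b + 2)"
      by (intro span_minimal subspace_R) auto
    finally show ?thesis using c(1) by blast
  qed
  have F_inj: "b1 = b2" if "b1 \<in> B" "b2 \<in> B" "F b1 = F b2" "F b1 \<noteq> 0" for b1 b2
  proof -
    have "coord b1 \<in> E ` coord ` B" "coord b2 \<in> E ` coord ` B"
      using that by (auto simp: F_def split: if_splits)
    with F_B that have "coord b1 = coord b2" by metis
    with that show ?thesis by (simp add: coord_inject)
  qed
  show "dual_perfect_map scale g B F"
    unfolding dual_perfect_map_def
  proof (intro conjI ballI impI)
    show "F \<in> B \<rightarrow> B \<union> {0}" using F_B by (auto simp: F_def)
    show "\<exists>c. c \<noteq> 0 \<and> g b - scale c (F b) \<in> R (ell g b + 2)" if "b \<in> B" for b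
      using that by (rule F_approx)
    show "b = b'" if "b \<in> B" "b' \<in> B" "F b = F b' \<and> F b \<noteq> 0" for b b'
      using F_inj that by blast
  qed
qed

end

section \<open>Consequences of a dual perfect map on the basis\<close>

context
  fixes F
  assumes F: "dual_perfect_map scale g B F"
begin

lemma F_inj: "b \<in> B \<Longrightarrow> b' \<in> B \<Longrightarrow> F b = F b' \<Longrightarrow> F b \<in> B \<Longrightarrow> b = b'"
  using F zero_notin_basis unfolding dual_perfect_map_def by metis

lemma raising_eq:
  assumes "b' \<in> B" "F b' = b" "b \<in> B"
  shows "raising B F b = b'"
proof -
  have "(THE b'. b' \<in> B \<and> F b' = b) = b'"
  proof (rule the_equality)
    show "b'' = b'" if "b'' \<in> B \<and> F b'' = b" for b''
      using that F_inj[of b'' b'] assms by simp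
  qed (use assms in blast)
  then show ?thesis using assms by (auto simp: raising_def)
qed

lemma raising_step:
  assumes b: "b \<in> B" and m: "ell g b = Suc m"
  obtains b' c where "b' \<in> B" "b' \<in> R m" "F b' = b" "raising B F b = b'" "c \<noteq> 0"
    "\<And>x. x \<in> R m \<Longrightarrow> coord b (g x) = c * coord b' x"
proof -
  have ad: adapted using F by (rule adaptedI_dual_perfect_map)
  have top: "coord b x = 0" if "x \<in> R (Suc (Suc m))" for x
  proof -
    have "b \<notin> R (Suc (Suc m))" using m mem_R_iff[OF b, of "Suc (Suc m)"] by simp
    then show ?thesis
      using ad b that unfolding adapted_iff transpose_funpow_eq_0_iff by blast
  qed
  have ex: "\<exists>c. c \<noteq> 0 \<and> coord b (g b') = (if F b' = b then c else 0)" if b': "b' \<in> B" "b' \<in> R m" for b'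
  proof -
    obtain c where c: "c \<noteq> 0" "g b' - scale c (F b') \<in> R (ell g b' + 2)"
      using F b' unfolding dual_perfect_map_def by blast
    have "m \<le> ell g b'" using b' mem_R_iff by blast
    then have "coord b (g b' - scale c (F b')) = 0"
      using c(2) top R_antimono[of "Suc (Suc m)" "ell g b' + 2"] by auto
    then have "coord b (g b') = c * coord b (F b')"
      using b by (simp add: coord_diff coord_scale)
    moreover have "F b' \<in> B \<union> {0}"
      using F b' by (auto simp: dual_perfect_map_def)
    then have "coord b (F b') = (if F b' = b then 1 else 0)"
      using b coord_basis[of b "F b'"] coord_diff[of b 0 0] zero_notin_basis by auto
    ultimately show ?thesis using c(1) by auto
  qed
  have span: "R m \<subseteq> span (B \<inter> R m)" using ad by (simp add: adapted_def)
  have "\<exists>b'. b' \<in> B \<and> b' \<in> R m \<and> F b' = b"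
  proof (rule ccontr)
    assume none: "\<not> ?thesis"
    have "coord b (g b') = 0" if "b' \<in> B \<inter> R m" for b'
      using ex[of b'] that none by auto
    then have "coord b x = 0" if "x \<in> span (g ` (B \<inter> R m))" for x
      using coord_eq_0_on_span[OF b _ that] by blast
    moreover have "R (Suc m) \<subseteq> span (g ` (B \<inter> R m))"
      using span unfolding R_Suc g.span_image by blast
    moreover have "b \<in> R (Suc m)" using m mem_R_iff[OF b] by (metis order_refl)
    ultimately show False using coord_basis[OF b b] by auto
  qed
  then obtain b' where b': "b' \<in> B" "b' \<in> R m" "F b' = b" by blast
  obtain c where c: "c \<noteq> 0" "coord b (g b') = c" using ex[OF b'(1,2)] b'(3) by auto
  have "coord b (g x) = c * coord b' x" if "x \<in> R m" for x
  proof -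
    have *: "coord b (g y) = c * coord b' y" if "y \<in> B \<inter> R m" for y
    proof (cases "y = b'")
      case False
      then have "F y \<noteq> b"
        using F_inj[of y b'] that b b' by auto
      then show ?thesis using ex[of y] that False b' by (auto simp: coord_basis)
    qed (use c b' in \<open>simp add: coord_basis\<close>)
    \<comment> \<open>Both sides are linear in \<open>x\<close>, so the identity passes from the
      basis vectors in \<open>R m\<close> to their span, which contains \<open>R m\<close>.\<close>
    have "subspace {x. coord b (g x) = c * coord b' x}"
      using coord_add coord_scale b b' coord_diff[of _ 0 0]
      by (auto simp: subspace_def g.zero g.add g.scale algebra_simps)
    then have "span (B \<inter> R m) \<subseteq> {x. coord b (g x) = c * coord b' x}"
      using * by (intro span_minimal) auto
    with that span show ?thesis by blast
  qed
  then show ?thesis using that b' raising_eq[OF b'(1,3) b] c(1) by blast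
qed

text \<open>If \<open>F b' = b\<close>, then a nonzero multiple of \<open>b\<close> is
  \<open>g b'\<close> minus an error in \<open>R 2\<close>, so \<open>b\<close> would lie in
  \<open>R 1\<close>.\<close>

lemma raising_eq_0:
  assumes b: "b \<in> B" and "ell g b = 0"
  shows "raising B F b = 0"
proof -
  have "F b' \<noteq> b" if b': "b' \<in> B" for b'
  proof
    assume eq: "F b' = b"
    obtain c where c: "c \<noteq> 0" "g b' - scale c b \<in> R (ell g b' + 2)"
      using F b' eq unfolding dual_perfect_map_def by blast
    then have "g b' - scale c b \<in> R 1" using R_antimono[of 1 "ell g b' + 2"] by auto
    moreover have "g b' \<in> R 1" by simp
    ultimately have "g b' - (g b' - scale c b) \<in> R 1"
      using subspace_diff[OF subspace_R] by blast
    then have "scale (inverse c) (scale c b) \<in> R 1"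
      using subspace_scale[OF subspace_R] by (metis diff_diff_eq2 add_diff_cancel_left')
    then show False using c mem_R_iff[OF b, of 1] assms(2) by simp
  qed
  then show ?thesis by (auto simp: raising_def)
qed

text \<open>This is the raising operator transported along \<open>coord\<close>, whose inverse on
  the dual basis is \<open>inv_into B coord\<close>. It is injective away from 0 because
  \<open>F\<close> undoes \<open>raising B F\<close> there.\<close>

lemma perfect_map_raising:
  "perfect_map dual_scale W e (coord ` B) (\<lambda>\<phi>. coord (raising B F (inv_into B coord \<phi>)))"
proof -
  have ad: adapted using F by (rule adaptedI_dual_perfect_map)
  have inv: "inv_into B coord (coord b) = b" if "b \<in> B" for b
    using that inj_on_coord by simp
  have zero: "coord (raising B F b) = 0" if "b \<in> B" "ell_check e (coord b) = 0" for b
    using that raising_eq_0[of b] ell_eq_ell_check[OF ad, of b] coord_zero by simp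
  have pos: "coord (raising B F b) \<in> coord ` B \<and> (\<exists>c. c \<noteq> 0 \<and>
      e (coord b) - dual_scale c (coord (raising B F b))
        \<in> {w \<in> W. (e ^^ (ell_check e (coord b) - 1)) w = 0})"
    if b: "b \<in> B" and pos: "ell_check e (coord b) > 0" for b
  proof -
    obtain m where m: "ell_check e (coord b) = Suc m" using pos gr0_conv_Suc by blast
    then have "ell g b = Suc m" using ell_eq_ell_check[OF ad b] by simp
    then obtain b' c where b': "b' \<in> B" "raising B F b = b'" "c \<noteq> 0"
      "\<And>x. x \<in> R m \<Longrightarrow> coord b (g x) = c * coord b' x"
      using raising_step[OF b] by blast
    have "e (coord b) - dual_scale c (coord b') \<in> W"
      by (intro D.subspace_diff[OF subspace_W] D.subspace_scale[OF subspace_W] transpose_W dual_W b b')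
    then show ?thesis
      using b' m by (auto simp: transpose_diff_kernel_iff intro!: exI[of _ c])
  qed
  have inj: "b1 = b2" if "b1 \<in> B" "b2 \<in> B" "coord (raising B F b1) = coord (raising B F b2)"
    "coord (raising B F b1) \<noteq> 0" for b1 b2
  proof -
    have ex: "\<exists>m. ell g b = Suc m" if "b \<in> B" "coord (raising B F b) \<noteq> 0" for b
      using that zero[of b] ell_eq_ell_check[OF ad, of b] not0_implies_Suc by metis
    have F_raising: "raising B F b \<in> B \<and> F (raising B F b) = b"
      if "b \<in> B" "coord (raising B F b) \<noteq> 0" for b
      using ex[OF that] raising_step[OF that(1)] by metis
    show ?thesis using F_raising that coord_inject by metis
  qed
  show ?thesis
    unfolding perfect_map_def
  proof (intro conjI ballI impI)
    show "(\<lambda>\<phi>. coord (raising B F (inv_into B coord \<phi>))) \<in> coord ` B \<rightarrow> coord ` B \<union> {0}"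
    proof
      fix \<phi> assume "\<phi> \<in> coord ` B"
      then obtain b where b: "b \<in> B" "\<phi> = coord b" by blast
      show "coord (raising B F (inv_into B coord \<phi>)) \<in> coord ` B \<union> {0}"
        using zero[OF b(1)] pos[OF b(1)] b by (cases "ell_check e (coord b) = 0") (auto simp: inv)
    qed
  next
    fix \<phi> \<psi> assume "\<phi> \<in> coord ` B" "\<psi> \<in> coord ` B"
      and *: "coord (raising B F (inv_into B coord \<phi>)) = coord (raising B F (inv_into B coord \<psi>)) \<and>
       coord (raising B F (inv_into B coord \<phi>)) \<noteq> 0"
    then obtain b b' where b: "b \<in> B" "\<phi> = coord b" "b' \<in> B" "\<psi> = coord b'" by blast
    show "\<phi> = \<psi>"
      using * inj[OF b(1,3)] unfolding b(2,4) inv[OF b(1)] inv[OF b(3)] by blast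
  next
    fix \<phi> assume "\<phi> \<in> coord ` B" and l: "ell_check e \<phi> = 0"
    then obtain b where b: "b \<in> B" "\<phi> = coord b" by blast
    show "coord (raising B F (inv_into B coord \<phi>)) = 0"
      using zero[OF b(1)] l unfolding b(2) inv[OF b(1)] by blast
  next
    fix \<phi> assume "\<phi> \<in> coord ` B" and l: "ell_check e \<phi> > 0"
    then obtain b where b: "b \<in> B" "\<phi> = coord b" by blast
    show "coord (raising B F (inv_into B coord \<phi>)) \<in> coord ` B"
      and "\<exists>c. c \<noteq> 0 \<and> e \<phi> - dual_scale c (coord (raising B F (inv_into B coord \<phi>)))
        \<in> {w \<in> W. (e ^^ (ell_check e \<phi> - 1)) w = 0}"
      using pos[OF b(1)] l unfolding b(2) inv[OF b(1)] by blast+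
  qed
qed

text \<open>At positive level both candidates \<open>b1\<close> and \<open>b2\<close> describe the
  same functional on \<open>R m\<close> up to nonzero scalars. Evaluating at \<open>b1\<close>,
  which lies in \<open>R m\<close>, forces them to coincide.\<close>

lemma coord_raising:
  assumes E: "perfect_map dual_scale W e (coord ` B) E" and b: "b \<in> B"
  shows "coord (raising B F b) = E (coord b)"
proof -
  have ad: adapted using F by (rule adaptedI_dual_perfect_map)
  show ?thesis
  proof (cases "ell g b")
    case 0
    then have "ell_check e (coord b) = 0" using ell_eq_ell_check[OF ad b] by simp
    then have "E (coord b) = 0"
      using E b unfolding perfect_map_def by blast
    then show ?thesis using raising_eq_0[OF b 0] coord_zero by simp
  next
    case (Suc m)
    obtain b1 c1 where b1: "b1 \<in> B" "b1 \<in> R m" "F b1 = b" "raising B F b = b1" "c1 \<noteq> 0"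
      "\<And>x. x \<in> R m \<Longrightarrow> coord b (g x) = c1 * coord b1 x"
      by (rule raising_step[OF b Suc]) (rule that)
    have "ell_check e (coord b) = Suc m" using Suc ell_eq_ell_check[OF ad b] by simp
    then obtain b2 c2 where b2: "b2 \<in> B" "E (coord b) = coord b2" "c2 \<noteq> 0"
      "\<And>x. x \<in> R m \<Longrightarrow> coord b (g x) = c2 * coord b2 x" "ell_check e (coord b2) = m"
      by (rule perfect_map_step[OF E b]) (rule that)
    have "c1 * coord b1 b1 = c2 * coord b2 b1"
      using b1(6)[OF b1(2)] b2(4)[OF b1(2)] by simp
    then have "b1 = b2"
      using b1(1,5) b2(1) by (auto simp: coord_basis split: if_splits)
    then show ?thesis using b1(4) b2(2) by simp
  qed
qed

end

end


section \<open>Gradings\<close>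

text \<open>If no power killed \<open>x\<close>, all \<mu> + n \<alpha>_i would be weights. The
  coefficient of \<alpha>_i is nonnegative on the root cone, so finitely many upper bounds \<kappa>
  allow only boundedly many \<open>n\<close>.\<close>

lemma (in pre_perfect_space) raising_operator_nilpotent:
  assumes i: "i \<in> I" and x: "x \<in> Wg \<mu>"
  shows "\<exists>n. (e i ^^ n) x = 0"
proof (rule ccontr)
  assume nz: "\<nexists>n. (e i ^^ n) x = 0"
  interpret Z: module "int_scale :: int \<Rightarrow> 'p \<Rightarrow> 'p" by (rule module_int_scale)
  \<comment> \<open>Outside the span of the roots this coefficient is 0 by convention; a bound
    \<kappa> with \<kappa> - \<mu> there merely adds an entry to the maximum below.\<close>
  let ?c = "\<lambda>q. Z.representation (\<alpha> ` I) q (\<alpha> i)"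
  have root: "\<alpha> j \<in> Z.span (\<alpha> ` I)" if "j \<in> I" for j
    using that by (simp add: Z.span_base)
  have c_root: "?c (\<alpha> j) \<ge> 0" if "j \<in> I" for j
    using that by (simp add: Z.representation_basis[OF roots_independent(2)])
  have cone: "q \<in> Z.span (\<alpha> ` I) \<and> ?c q \<ge> 0" if mem: "q \<in> root_cone I \<alpha>" for q
  proof -
    obtain J n where J: "finite J" "J \<subseteq> I" and q: "q = (\<Sum>j\<in>J. int_scale (int (n j)) (\<alpha> j))"
      using mem unfolding root_cone_def by blast
    have span: "int_scale (int (n j)) (\<alpha> j) \<in> Z.span (\<alpha> ` I)" if "j \<in> J" for j
      using that J root by (blast intro: Z.span_scale)
    then have "q \<in> Z.span (\<alpha> ` I)" unfolding q by (rule Z.span_sum)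
    moreover have "?c q = (\<Sum>j\<in>J. int (n j) * ?c (\<alpha> j))"
      unfolding q
      by (subst Z.representation_sum[OF roots_independent(2)], fact span)
        (use J root in \<open>auto intro!: sum.cong simp: Z.representation_scale[OF roots_independent(2)]\<close>)
    then have "?c q \<ge> 0"
      using c_root J by (auto intro!: sum_nonneg)
    ultimately show ?thesis by blast
  qed
  have power: "(e i ^^ n) x \<in> Wg (\<mu> + int_scale (int n) (\<alpha> i))" for n
  proof (induction n)
    case 0
    show ?case using x by (simp add: int_scale_simps)
  next
    case (Suc n)
    have "\<mu> + int_scale (int (Suc n)) (\<alpha> i) = \<mu> + int_scale (int n) (\<alpha> i) + \<alpha> i"
      using int_scale_add_left[of "int n" 1 "\<alpha> i"] by (simp add: int_scale_simps algebra_simps)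
    moreover have "e i ((e i ^^ n) x) \<in> Wg (\<mu> + int_scale (int n) (\<alpha> i) + \<alpha> i)"
      using e_weight[OF i] Suc by blast
    ultimately show ?case by (simp add: add.assoc)
  qed
  then have wt: "\<mu> + int_scale (int n) (\<alpha> i) \<in> weights Wg" for n
    using nz by (auto simp: weights_def)
  obtain L where L: "finite L" "weights Wg \<subseteq> (\<Union>\<kappa>\<in>L. {\<kappa> - q | q. q \<in> root_cone I \<alpha>})"
    using bounded unfolding weights_bounded_def by blast
  have bound: "int n \<le> Max ((\<lambda>\<kappa>. ?c (\<kappa> - \<mu>)) ` L)" for n
  proof -
    obtain \<kappa> q where \<kappa>: "\<kappa> \<in> L" "q \<in> root_cone I \<alpha>" "\<mu> + int_scale (int n) (\<alpha> i) = \<kappa> - q"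
      using wt[of n] L(2) by blast
    then have "\<kappa> - \<mu> = int_scale (int n) (\<alpha> i) + q" by (simp add: algebra_simps)
    then have "?c (\<kappa> - \<mu>) = int n * ?c (\<alpha> i) + ?c q"
      using cone[OF \<kappa>(2)] root[OF i]
      by (simp add: Z.representation_add[OF roots_independent(2)] Z.span_scale
          Z.representation_scale[OF roots_independent(2)])
    also have "?c (\<alpha> i) = 1"
      using i by (simp add: Z.representation_basis[OF roots_independent(2)])
    finally have "int n \<le> ?c (\<kappa> - \<mu>)" using cone[OF \<kappa>(2)] by simp
    also have "\<dots> \<le> Max ((\<lambda>\<kappa>. ?c (\<kappa> - \<mu>)) ` L)"
      using L(1) \<kappa>(1) by (intro Max_ge) auto
    finally show ?thesis .
  qed
  show False
    using bound[of "nat (Max ((\<lambda>\<kappa>. ?c (\<kappa> - \<mu>)) ` L)) + 1"] by linarith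
qed

section \<open>Homogeneity of a basis and of its dual basis\<close>

lemma (in graded_space) component_unique:
  assumes "x \<in> Wg \<mu>" "x \<in> Wg \<nu>" "x \<noteq> 0"
  shows "\<mu> = \<nu>"
proof (rule ccontr)
  assume "\<mu> \<noteq> \<nu>"
  then have "x \<in> span (\<Union>\<rho>\<in>- {\<mu>}. Wg \<rho>)" using assms(2) by (auto intro: span_base)
  with assms show False using component_inter_others by blast
qed

text \<open>Distinct components meet only in 0, so disjointness is automatic.\<close>

lemma (in graded_space) homogeneous_iff:
  assumes "0 \<notin> B"
  shows "homogeneous Wg B \<longleftrightarrow> B \<subseteq> (\<Union>\<mu>. Wg \<mu>)"
proof -
  have "disjoint_family (\<lambda>\<mu>. B \<inter> Wg \<mu>)"
    unfolding disjoint_family_on_def using component_unique assms by blast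
  then show ?thesis unfolding homogeneous_def by blast
qed

lemma dual_comp_other_eq_0:
  "\<phi> \<in> dual_comp scale V \<kappa> \<Longrightarrow> \<mu> \<noteq> \<kappa> \<Longrightarrow> v \<in> V \<mu> \<Longrightarrow> \<phi> v = 0"
  by (simp add: dual_comp_def)

text \<open>A vector of weight \<mu> is a combination of basis vectors of weight \<mu>: the rest of
  its expansion lies both in that component and in the span of the others, so it is 0. Hence its
  coordinate at \<open>b\<close> vanishes for \<mu> different from \<kappa>.\<close>

lemma (in graded_space) dual_vector_mem_dual_comp:
  assumes B: "is_basis scale UNIV B" "B \<subseteq> (\<Union>\<mu>. Wg \<mu>)" and b: "b \<in> B" "b \<in> Wg \<kappa>"
  shows "dual_vector scale B b \<in> dual_comp scale Wg \<kappa>"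
proof -
  have "dual_vector scale B b v = 0" if \<mu>: "\<mu> \<noteq> \<kappa>" and v: "v \<in> Wg \<mu>" for \<mu> v
  proof -
    have "B = (B \<inter> Wg \<mu>) \<union> (B - Wg \<mu>)" by blast
    then have "v \<in> span ((B \<inter> Wg \<mu>) \<union> (B - Wg \<mu>))"
      using B(1) by (simp add: is_basis_def)
    then obtain x y where xy: "v = x + y" "x \<in> span (B \<inter> Wg \<mu>)" "y \<in> span (B - Wg \<mu>)"
      unfolding span_Un by blast
    have "span (B \<inter> Wg \<mu>) \<subseteq> Wg \<mu>"
      by (intro span_minimal subspace_component) auto
    then have "v - x \<in> Wg \<mu>"
      using v xy(2) subspace_diff[OF subspace_component] by blast
    moreover have "B - Wg \<mu> \<subseteq> (\<Union>\<nu>\<in>- {\<mu>}. Wg \<nu>)"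
    proof
      fix b assume b: "b \<in> B - Wg \<mu>"
      then obtain \<nu> where "b \<in> Wg \<nu>" using B(2) by auto
      with b show "b \<in> (\<Union>\<nu>\<in>- {\<mu>}. Wg \<nu>)" by auto
    qed
    then have "v - x \<in> span (\<Union>\<nu>\<in>- {\<mu>}. Wg \<nu>)"
      using xy(1,3) span_mono by auto
    ultimately have "v - x = 0" by (rule component_inter_others)
    then have "v \<in> span (B \<inter> Wg \<mu>)" using xy(2) by simp
    moreover have "b \<noteq> 0" using B(1) b(1) dependent_zero by (auto simp: is_basis_def)
    then have "b \<notin> Wg \<mu>" using component_unique b(2) \<mu> by blast
    ultimately show ?thesis
      using mem_span_subset_basis_iff[OF B(1) Int_lower1] b(1) by blast
  qed
  then show ?thesis
    using dual_vector(1)[OF vector_space_axioms B(1) b(1)] by (auto simp: dual_comp_def)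
qed

lemma (in graded_space) dual_homogeneous_if_basis_homogeneous:
  assumes B: "is_basis scale UNIV B" "B \<subseteq> (\<Union>\<mu>. Wg \<mu>)"
  shows "dual_vector scale B ` B \<subseteq> (\<Union>\<kappa>. dual_comp scale Wg \<kappa>)"
proof (rule image_subsetI)
  fix b assume b: "b \<in> B"
  then obtain \<mu> where "b \<in> Wg \<mu>" using B(2) by auto
  then show "dual_vector scale B b \<in> (\<Union>\<kappa>. dual_comp scale Wg \<kappa>)"
    using dual_vector_mem_dual_comp[OF B b] by auto
qed

text \<open>Split \<open>b\<close> as \<open>y + u\<close>, where \<open>y\<close> has the weight
  \<open>k b\<close> of the dual vector of \<open>b\<close>. Coordinates of weight
  \<open>k b\<close> vanish on \<open>u\<close>; those of another weight vanish on \<open>y\<close>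
  and on \<open>b\<close>, hence on \<open>u\<close>. So \<open>u\<close> is 0.\<close>

lemma (in graded_space) basis_homogeneous_if_dual_homogeneous:
  assumes W: "W = UNIV" and B: "is_basis scale UNIV B"
    and dual: "dual_vector scale B ` B \<subseteq> (\<Union>\<kappa>. dual_comp scale Wg \<kappa>)"
  shows "B \<subseteq> (\<Union>\<mu>. Wg \<mu>)"
proof
  fix b assume b: "b \<in> B"
  let ?d = "dual_vector scale B"
  have "\<forall>b\<in>B. \<exists>\<kappa>. ?d b \<in> dual_comp scale Wg \<kappa>" using dual by blast
  then obtain k where k: "\<And>b. b \<in> B \<Longrightarrow> ?d b \<in> dual_comp scale Wg (k b)" by metis
  have "(\<Union>\<mu>. Wg \<mu>) = Wg (k b) \<union> (\<Union>\<mu>\<in>- {k b}. Wg \<mu>)" by auto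
  then have "b \<in> span (Wg (k b) \<union> (\<Union>\<mu>\<in>- {k b}. Wg \<mu>))"
    using span_components W by simp
  then obtain y u where yu: "b = y + u" "y \<in> span (Wg (k b))" "u \<in> span (\<Union>\<mu>\<in>- {k b}. Wg \<mu>)"
    unfolding span_Un by blast
  have y: "y \<in> Wg (k b)" using yu(2) subspace_component span_eq_iff by blast
  have "?d b' u = 0" if b': "b' \<in> B" for b'
  proof -
    interpret d: Vector_Spaces.linear scale "(*)" "?d b'"
      by (rule dual_vector(1)[OF vector_space_axioms B b'])
    show ?thesis
    proof (cases "k b' = k b")
      case True
      then have "?d b' x = 0" if "x \<in> (\<Union>\<mu>\<in>- {k b}. Wg \<mu>)" for x
        using dual_comp_other_eq_0[OF k[OF b']] True that by auto
      then show ?thesis using yu(3) by (rule d.eq_0_on_span)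
    next
      case False
      then have "?d b' y = 0" using dual_comp_other_eq_0[OF k[OF b'] _ y] by simp
      moreover have "?d b' b = 0"
        using dual_vector(2)[OF vector_space_axioms B b' b] False by auto
      ultimately show ?thesis using yu(1) d.add by simp
    qed
  qed
  then have "u \<in> span {}" unfolding mem_span_subset_basis_iff[OF B empty_subsetI] by blast
  with yu(1) y show "b \<in> (\<Union>\<mu>. Wg \<mu>)" by auto
qed

text \<open>Evaluation at basis vectors gives independence. For spanning, finite dimension makes the
  part of \<open>B\<close> in each component finite, so a homogeneous functional is a finite sum of
  its values times coordinates.\<close>

lemma is_basis_dual:
  fixes scale :: "'k::field \<Rightarrow> 'v::ab_group_add \<Rightarrow> 'v"
  assumes "graded_space scale UNIV V" and fin: "\<And>\<kappa>. finite_dim scale (V \<kappa>)"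
    and B: "is_basis scale UNIV B" "B \<subseteq> (\<Union>\<mu>. V \<mu>)"
  shows "is_basis dual_scale (graded_dual scale V) (dual_vector scale B ` B)"
proof -
  let ?d = "dual_vector scale B"
  interpret graded_space scale UNIV V by fact
  interpret D: vector_space "dual_scale :: 'k \<Rightarrow> ('v \<Rightarrow> 'k) \<Rightarrow> 'v \<Rightarrow> 'k"
    by (rule vector_space_dual_scale)
  have d_basis: "?d b b' = (if b = b' then 1 else 0)" if "b \<in> B" "b' \<in> B" for b b'
    using dual_vector(2)[OF vector_space_axioms B(1)] that .
  have inj: "inj_on ?d B"
    using d_basis by (intro inj_onI) (metis zero_neq_one)
  have sum_apply: "(\<Sum>b\<in>T. dual_scale (r b) (?d b)) v = (\<Sum>b\<in>T. r b * ?d b v)" for T r v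
    by (induction T rule: infinite_finite_induct) (auto simp: dual_scale_def)
  have d_comp: "?d ` B \<subseteq> (\<Union>\<kappa>. dual_comp scale V \<kappa>)"
    using B by (rule dual_homogeneous_if_basis_homogeneous)
  have "D.independent (?d ` B)"
    unfolding D.independent_explicit_module
  proof (intro allI impI)
    fix t u \<phi> assume t: "finite t" "t \<subseteq> ?d ` B" "(\<Sum>\<psi>\<in>t. dual_scale (u \<psi>) \<psi>) = 0" "\<phi> \<in> t"
    obtain T where T: "finite T" "T \<subseteq> B" "t = ?d ` T"
      using finite_subset_image[OF t(1,2)] by blast
    obtain b where b: "b \<in> T" "\<phi> = ?d b" using t(4) T(3) by auto
    have "(\<Sum>x\<in>T. dual_scale (u (?d x)) (?d x)) = 0"
      using t(3) inj_on_subset[OF inj T(2)] unfolding T(3) by (simp add: sum.reindex)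
    then have "0 = (\<Sum>x\<in>T. u (?d x) * ?d x b)"
      using sum_apply[of "\<lambda>x. u (?d x)" T b] by simp
    also have "\<dots> = (\<Sum>x\<in>T. if x = b then u (?d b) else 0)"
    proof (rule sum.cong)
      fix x assume "x \<in> T"
      then have "x \<in> B" "b \<in> B" using T(2) b(1) by auto
      then show "u (?d x) * ?d x b = (if x = b then u (?d b) else 0)" by (simp add: d_basis)
    qed simp
    finally show "u \<phi> = 0" using T b by simp
  qed
  moreover have "D.span (?d ` B) = graded_dual scale V"
    unfolding graded_dual_def
  proof (rule equalityI[OF D.span_mono[OF d_comp] D.span_minimal[OF subsetI D.subspace_span]])
    fix \<phi> assume "\<phi> \<in> (\<Union>\<kappa>. dual_comp scale V \<kappa>)"
    then obtain \<kappa> where \<phi>: "\<phi> \<in> dual_comp scale V \<kappa>" by auto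
    let ?T = "B \<inter> V \<kappa>"
    obtain S where S: "finite S" "span S = V \<kappa>" using fin unfolding finite_dim_def by blast
    have "independent ?T" using B(1) independent_mono by (auto simp: is_basis_def)
    then have T: "finite ?T" using independent_span_bound[OF S(1)] S(2) by blast
    let ?s = "\<lambda>v. \<Sum>b\<in>?T. \<phi> b * ?d b v"
    interpret \<phi>: Vector_Spaces.linear scale "(*)" \<phi> using \<phi> by (simp add: dual_comp_def)
    have lin: "Vector_Spaces.linear scale (*) (?d b)" if "b \<in> B" for b
      using dual_vector(1)[OF vector_space_axioms B(1) that] .
    interpret P: vector_space_pair scale "(*) :: 'k \<Rightarrow> 'k \<Rightarrow> 'k"
      by unfold_locales (simp_all add: algebra_simps)
    have "Vector_Spaces.linear scale (*) ?s"
      using lin by (intro P.linear_compose_sum P.linear_compose_scale_right ballI) auto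
    \<comment> \<open>For \<open>b\<close> of weight other than \<kappa> both sides are 0.\<close>
    moreover have "?s b = \<phi> b" if b: "b \<in> B" for b
    proof -
      have "?s b = (\<Sum>x\<in>?T. if x = b then \<phi> b else 0)"
        using b by (intro sum.cong) (auto simp: d_basis)
      also have "\<dots> = (if b \<in> V \<kappa> then \<phi> b else 0)" using T b by simp
      also have "\<dots> = \<phi> b"
      proof -
        obtain \<mu> where "b \<in> V \<mu>" using b B(2) by auto
        then show ?thesis using dual_comp_other_eq_0[OF \<phi>, of \<mu> b] by auto
      qed
      finally show ?thesis .
    qed
    ultimately have "?s v = \<phi> v" for v
      using B(1) \<phi>.linear_axioms by (intro P.linear_eq_on[of ?s \<phi> v B]) (auto simp: is_basis_def)
    then have "\<phi> = (\<Sum>b\<in>?T. dual_scale (\<phi> b) (?d b))"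
      by (simp add: fun_eq_iff sum_apply)
    also have "\<dots> \<in> D.span (?d ` B)"
      by (intro D.span_sum D.span_scale D.span_base) auto
    finally show "\<phi> \<in> D.span (?d ` B)" .
  qed
  moreover from this have "?d ` B \<subseteq> graded_dual scale V"
    using D.span_superset by blast
  ultimately show ?thesis by (simp add: is_basis_def)
qed

section \<open>Separating a basis vector from an image\<close>

lemma (in vector_space) exists_separating_functional:
  assumes U: "subspace U" and b: "b \<notin> U"
  shows "\<exists>\<phi>. Vector_Spaces.linear scale (*) \<phi> \<and> (\<forall>x\<in>U. \<phi> x = 0) \<and> \<phi> b = 1"
proof -
  interpret P: vector_space_pair scale "(*) :: 'a \<Rightarrow> 'a \<Rightarrow> 'a"
    by unfold_locales (simp_all add: algebra_simps)
  obtain S where S: "S \<subseteq> U" "independent S" "U \<subseteq> span S"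
    using maximal_independent_subset by blast
  have "b \<notin> span S" using b span_minimal[OF S(1) U] by blast
  then have "independent (insert b S)" using S(2) independent_insertI by blast
  then obtain \<phi> where \<phi>: "Vector_Spaces.linear scale (*) \<phi>"
    "\<forall>x\<in>insert b S. \<phi> x = (if x = b then 1 else 0)"
    using P.linear_independent_extend[of "insert b S" "\<lambda>x. if x = b then 1 else 0"] by blast
  interpret \<phi>: Vector_Spaces.linear scale "(*)" \<phi> by fact
  have on_S: "\<phi> x = 0" if "x \<in> S" for x using \<phi>(2) that b S(1) by auto
  have "\<forall>x\<in>U. \<phi> x = 0"
  proof
    fix x assume "x \<in> U"
    then have "x \<in> span S" using S(3) by blast
    with on_S show "\<phi> x = 0" by (rule \<phi>.eq_0_on_span)
  qed
  moreover have "\<phi> b = 1" using \<phi>(2) by simp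
  ultimately show ?thesis using \<phi>(1) by blast
qed

text \<open>A separating functional \<psi> need not be graded, so it is cut down to the component of
  \<open>b\<close> and extended by 0. The result still kills the image, because \<open>g\<close>
  maps components into components: there it agrees with \<psi> or is 0.\<close>

lemma (in graded_space) exists_separating_dual_comp:
  assumes W: "W = UNIV" and g: "Vector_Spaces.linear scale scale g"
    and hom: "\<And>\<mu>. \<exists>\<nu>. g ` Wg \<mu> \<subseteq> Wg \<nu>"
    and b: "b \<in> Wg \<mu>" "b \<notin> range g"
  shows "\<exists>\<phi>\<in>dual_comp scale Wg \<mu>. (\<forall>x\<in>range g. \<phi> x = 0) \<and> \<phi> b \<noteq> 0"
proof -
  interpret g: Vector_Spaces.linear scale scale g by fact
  have "subspace (range g)" using g.subspace_image subspace_UNIV by blast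
  then obtain \<psi> where \<psi>: "Vector_Spaces.linear scale (*) \<psi>" "\<forall>x\<in>range g. \<psi> x = 0" "\<psi> b = 1"
    using exists_separating_functional[OF _ b(2)] by blast
  interpret \<psi>: Vector_Spaces.linear scale "(*)" \<psi> by fact
  obtain \<phi> where \<phi>: "\<phi> \<in> dual_comp scale Wg \<mu>" "\<forall>x\<in>Wg \<mu>. \<phi> x = \<psi> x"
    using linear_functional_extension[OF W \<psi>.add \<psi>.scale] by blast
  have "Vector_Spaces.linear scale (*) (\<phi> \<circ> g)"
    using \<phi>(1) by (intro Vector_Spaces.linear_compose[OF g]) (simp add: dual_comp_def)
  then interpret \<phi>g: Vector_Spaces.linear scale "(*)" "\<phi> \<circ> g" .
  have on_components: "(\<phi> \<circ> g) v = 0" if v: "v \<in> (\<Union>\<mu>. Wg \<mu>)" for v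
  proof -
    obtain \<nu> where \<nu>: "g v \<in> Wg \<nu>" using hom v by blast
    show ?thesis
    proof (cases "\<nu> = \<mu>")
      case True
      then show ?thesis using \<nu> \<phi>(2) \<psi>(2) by simp
    next
      case False
      then show ?thesis using dual_comp_other_eq_0[OF \<phi>(1) _ \<nu>] by simp
    qed
  qed
  have "(\<phi> \<circ> g) v = 0" for v
  proof (rule \<phi>g.eq_0_on_span)
    show "v \<in> span (\<Union>\<mu>. Wg \<mu>)" by (simp add: span_components W)
  qed (rule on_components)
  moreover have "\<phi> b \<noteq> 0" using \<phi>(2) b(1) \<psi>(3) by simp
  ultimately show ?thesis using \<phi>(1) by auto
qed

section \<open>Transfer between the basis and its dual basis\<close>

theorem proposition7p3:
  fixes I :: "'i set"
    and A :: "'i \<Rightarrow> 'i \<Rightarrow> int"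
    and \<alpha> :: "'i \<Rightarrow> 'p::ab_group_add"
    and h :: "'i \<Rightarrow> 'p \<Rightarrow> int"
    and scale :: "'k::field \<Rightarrow> 'v::ab_group_add \<Rightarrow> 'v"
    and V :: "'p \<Rightarrow> 'v set"
    and f :: "'i \<Rightarrow> 'v \<Rightarrow> 'v"
    and B :: "'v set"
  assumes "pre_dual_perfect_space I A \<alpha> h scale V f"
    and "\<And>\<kappa>. finite_dim scale (V \<kappa>)"
    and "is_basis scale UNIV B"
  shows
    "(dual_perfect_basis I scale V f B \<longleftrightarrow>
        perfect_basis I dual_scale (graded_dual scale V) (dual_comp scale V)
          (\<lambda>i. transpose_op (f i)) (dual_vector scale B ` B))
     \<and>
     (dual_perfect_basis I scale V f B \<longrightarrow>
        (\<forall>i\<in>I.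
           (\<forall>b\<in>B. ell (f i) b = ell_check (transpose_op (f i)) (dual_vector scale B b)) \<and>
           (\<forall>F E. dual_perfect_map scale (f i) B F \<longrightarrow>
              perfect_map dual_scale (graded_dual scale V) (transpose_op (f i))
                (dual_vector scale B ` B) E \<longrightarrow>
              (\<forall>b\<in>B. dual_vector scale B (raising B F b) = E (dual_vector scale B b)))))"
proof -
  let ?d = "dual_vector scale B" and ?W = "graded_dual scale V" and ?D = "dual_comp scale V"
  interpret pre_dual_perfect_space I A \<alpha> h scale V f by fact
  interpret P: pre_perfect_space I A \<alpha> h dual_scale ?W ?D "\<lambda>i. transpose_op (f i)"
    by (rule pre_perfect_space_graded_dual) fact
  have B: "is_basis scale UNIV B" by fact
  have zero: "0 \<notin> B" "0 \<notin> ?d ` B"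
  proof -
    show "0 \<notin> B" using B dependent_zero by (auto simp: is_basis_def)
    have "?d b \<noteq> 0" if "b \<in> B" for b
      using dual_vector(2)[OF vector_space_axioms B that that] by (metis zero_fun_def zero_neq_one)
    then show "0 \<notin> ?d ` B" by auto
  qed
  \<comment> \<open>Either notion of perfectness includes homogeneity, so \<open>B\<close> may be
    taken homogeneous from here on; the dual basis then lies in the graded dual.\<close>
  have hom_iff: "homogeneous V B \<longleftrightarrow> homogeneous ?D (?d ` B)"
    unfolding homogeneous_iff[OF zero(1)] P.homogeneous_iff[OF zero(2)]
    using dual_homogeneous_if_basis_homogeneous[OF B] basis_homogeneous_if_dual_homogeneous[OF refl B]
    by (rule iffI)
  have basis: "is_basis dual_scale ?W (?d ` B)" if "homogeneous V B"
    using that assms(2) B unfolding homogeneous_iff[OF zero(1)] by (intro is_basis_dual graded_space_axioms) auto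
  have op: "transposed_operator scale B ?W (f i)" if hom: "homogeneous V B" and i: "i \<in> I" for i
  proof (intro transposed_operator.intro transposed_operator_axioms.intro vector_space_axioms)
    show "is_basis scale UNIV B" "Vector_Spaces.linear scale scale (f i)"
      using B linear_f[OF i] .
    show "P.subspace ?W" unfolding graded_dual_def by (rule P.subspace_span)
    show "transpose_op (f i) \<phi> \<in> ?W" if "\<phi> \<in> ?W" for \<phi>
      using P.e_closed[OF i] that by blast
    fix b assume b: "b \<in> B"
    show "?d b \<in> ?W" using basis[OF hom] b by (auto simp: is_basis_def)
    have "?d b \<in> (\<Union>\<kappa>. ?D \<kappa>)"
      using hom b unfolding hom_iff P.homogeneous_iff[OF zero(2)] by blast
    then show "\<exists>n. (transpose_op (f i) ^^ n) (?d b) = 0"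
      using P.raising_operator_nilpotent[OF i] by blast
  qed
  have map_iff: "(\<exists>F. dual_perfect_map scale (f i) B F) \<longleftrightarrow>
      (\<exists>E. perfect_map dual_scale ?W (transpose_op (f i)) (?d ` B) E)"
    if hom: "homogeneous V B" and i: "i \<in> I" for i
  proof -
    interpret T: transposed_operator scale B ?W "f i" by (rule op[OF hom i])
    have sep: "\<exists>\<phi>\<in>P.span (?d ` B). (\<forall>x\<in>range (f i ^^ n). \<phi> x = 0) \<and> \<phi> b \<noteq> 0"
      if b: "b \<in> B" "b \<notin> range (f i ^^ n)" for n b
    proof -
      obtain \<mu> where \<mu>: "b \<in> V \<mu>" using hom b(1) unfolding homogeneous_iff[OF zero(1)] by blast
      have shift: "\<exists>\<nu>. (f i ^^ n) ` V \<mu> \<subseteq> V \<nu>" for \<mu>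
      proof (induction n)
        case (Suc n)
        then obtain \<nu> where "(f i ^^ n) ` V \<mu> \<subseteq> V \<nu>" by blast
        then have "(f i ^^ Suc n) ` V \<mu> \<subseteq> V (\<nu> - \<alpha> i)" using f_weight[OF i, of \<nu>] by auto
        then show ?case by blast
      qed auto
      obtain \<phi> where \<phi>: "\<phi> \<in> ?D \<mu>" "(\<forall>x\<in>range (f i ^^ n). \<phi> x = 0) \<and> \<phi> b \<noteq> 0"
        using exists_separating_dual_comp[OF refl T.linear_funpow shift \<mu> b(2)] by (rule bexE)
      \<comment> \<open>Here finite dimension enters: the dual basis spans the graded dual, so the
        separating functional is a combination of coordinates.\<close>
      have "?D \<mu> \<subseteq> P.span (?d ` B)"
        using basis[OF hom] P.span_superset[of "\<Union>\<kappa>. ?D \<kappa>"]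
        unfolding is_basis_def graded_dual_def by blast
      then have "\<phi> \<in> P.span (?d ` B)" using \<phi>(1) by (rule subsetD)
      with \<phi>(2) show ?thesis by (rule bexI)
    qed
    show ?thesis
    proof
      assume "\<exists>F. dual_perfect_map scale (f i) B F"
      then show "\<exists>E. perfect_map dual_scale ?W (transpose_op (f i)) (?d ` B) E"
        using T.perfect_map_raising by (elim exE) (rule exI)
    next
      assume "\<exists>E. perfect_map dual_scale ?W (transpose_op (f i)) (?d ` B) E"
      then obtain E where E: "perfect_map dual_scale ?W (transpose_op (f i)) (?d ` B) E"
        by (rule exE)
      then have "T.adapted" using sep by (rule T.adaptedI_perfect_map)
      with E show "\<exists>F. dual_perfect_map scale (f i) B F"
        by (rule T.dual_perfect_map_exists)
    qed
  qed
  have "dual_perfect_basis I scale V f B \<longleftrightarrow>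
        perfect_basis I dual_scale ?W ?D (\<lambda>i. transpose_op (f i)) (?d ` B)"
    unfolding dual_perfect_basis_def perfect_basis_def using B hom_iff basis map_iff by blast
  moreover have "ell (f i) b = ell_check (transpose_op (f i)) (?d b)"
    and "dual_perfect_map scale (f i) B F \<Longrightarrow>
      perfect_map dual_scale ?W (transpose_op (f i)) (?d ` B) E \<Longrightarrow> ?d (raising B F b) = E (?d b)"
    if dpb: "dual_perfect_basis I scale V f B" and i: "i \<in> I" and b: "b \<in> B" for i b F E
  proof -
    have hom: "homogeneous V B" using dpb by (simp add: dual_perfect_basis_def)
    interpret T: transposed_operator scale B ?W "f i" by (rule op[OF hom i])
    obtain F' where "dual_perfect_map scale (f i) B F'"
      using dpb i unfolding dual_perfect_basis_def by blast
    then show "ell (f i) b = ell_check (transpose_op (f i)) (?d b)"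
      using T.ell_eq_ell_check[OF T.adaptedI_dual_perfect_map b] by blast
    show "?d (raising B F b) = E (?d b)"
      if "dual_perfect_map scale (f i) B F"
        "perfect_map dual_scale ?W (transpose_op (f i)) (?d ` B) E"
      using T.coord_raising[OF that b] .
  qed
  ultimately show ?thesis by blast
qed

end
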